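(* Let $K_n(\alpha,\theta)=\sum_{r=1}^n M_{r,n}(\alpha,\theta)$, where $(M_{1,n}(\alpha,\theta),\ldots,M_{n,n}(\alpha,\theta))$ is distributed as the Ewens-Pitman sampling model (EP-SM) with parameters $(\alpha,\theta)$, and let $K(\alpha,z,n)=\sum_{r=1}^n M_r(\alpha,z,n)$, where $(M_1(\alpha,z,n),\ldots,M_n(\alpha,z,n))$ is distributed as the negative Binomial compound Poisson sampling model (NB-CPSM) with parameters $(\alpha,z)$. Then, as $n\rightarrow+\infty$: (i) for $\alpha\in(0,1)$ and $\theta>-\alpha$, $$\frac{K_n(\alpha,\theta)}{n^\alpha}\stackrel{w}{\longrightarrow}S_{\alpha,\theta},$$ where $S_{\alpha,\theta}$ is the scaled Mittag-Leffler random variable defined in the context; (ii) for $\alpha<0$ and $z<0$, $$\frac{K(\alpha,z,n)}{n^{\frac{-\alpha}{1-\alpha}}}\stackrel{w}{\longrightarrow}\frac{(\alpha z)^{\frac{1}{1-\alpha}}}{-\alpha}.$$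
   Context: Notation: $\mathbb{N}=\{1,2,\ldots\}$; $(x)_{(n)}=\prod_{0\le i\le n-1}(x+i)$ is the ascending factorial, with $(x)_{(0)}=1$; $\stackrel{w}{\longrightarrow}$ denotes weak convergence (convergence in distribution) of random variables, where a constant limit is regarded as a degenerate random variable. Below, $x_1,\ldots,x_n$ are non-negative integers with $\sum_{i=1}^n i\,x_i=n$; all other vectors have probability zero. EP-SM: for $n\in\mathbb{N}$, $\alpha\in(0,1)$ and $\theta>-\alpha$, $$\Pr[(M_{1,n}(\alpha,\theta),\ldots,M_{n,n}(\alpha,\theta))=(x_1,\ldots,x_n)]=n!\,\frac{\left(\frac{\theta}{\alpha}\right)_{(\sum_{i=1}^n x_i)}}{(\theta)_{(n)}}\prod_{i=1}^n\frac{\left(\frac{\alpha(1-\alpha)_{(i-1)}}{i!}\right)^{x_i}}{x_i!},$$ where for $\theta=0$ the ratio $(\theta/\alpha)_{(k)}/(\theta)_{(n)}$ is understood as its limit as $\theta\to0$, i.e. $\frac{(k-1)!}{\alpha\,(n-1)!}$. Generalized factorial coefficients: $\mathscr{C}(n,j;\alpha)=\frac{1}{j!}\sum_{i=0}^{j}\binom{j}{i}(-1)^i(-i\alpha)_{(n)}$, with $\mathscr{C}(0,0;\alpha)=1$, $\mathscr{C}(n,0;\alpha)=0$ for $n\in\mathbb{N}$, and $\mathscr{C}(n,j;\alpha)=0$ for $j>n$. NB-CPSM: for $n\in\mathbb{N}$, $\alpha<0$ and $z<0$, $$\Pr[(M_1(\alpha,z,n),\ldots,M_n(\alpha,z,n))=(x_1,\ldots,x_n)]=\frac{n!}{\sum_{j=0}^n\mathscr{C}(n,j;\alpha)z^j}\prod_{i=1}^n\frac{\left[z\frac{\alpha(1-\alpha)_{(i-1)}}{i!}\right]^{x_i}}{x_i!}.$$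 Scaled Mittag-Leffler random variable: for $\alpha\in(0,1)$ let $f_\alpha$ be the density of the positive $\alpha$-stable random variable $X_\alpha$ with $\mathbb{E}[e^{-tX_\alpha}]=e^{-t^\alpha}$ for $t>0$. For $\theta>-\alpha$, $S_{\alpha,\theta}$ is the positive random variable with density $$f_{S_{\alpha,\theta}}(s)=\frac{\Gamma(\theta+1)}{\alpha\Gamma(\theta/\alpha+1)}s^{\frac{\theta-1}{\alpha}-1}f_\alpha(s^{-1/\alpha}),\quad s>0.$$ *)

theory Defs
  imports "HOL-Probability.Probability"
begin

text \<open>
  Vectors indexed by 1, ..., n are functions on the natural numbers of which only the values
  on \<open>{1..n}\<close> are used. The real number \<open>pochhammer x n\<close> is the ascending factorial of order n.
\<close>

text \<open>
  The division is by zero when \<open>\<theta> = 0\<close>, so the limit for \<open>\<theta> \<rightarrow> 0\<close> is given explicitly.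
\<close>

definition rising_ratio :: "real \<Rightarrow> real \<Rightarrow> nat \<Rightarrow> nat \<Rightarrow> real" where
  "rising_ratio \<alpha> \<theta> k n =
     (if \<theta> = 0 then fact (k - 1) / (\<alpha> * fact (n - 1))
      else pochhammer (\<theta> / \<alpha>) k / pochhammer \<theta> n)"

definition EP_SM_prob :: "real \<Rightarrow> real \<Rightarrow> nat \<Rightarrow> (nat \<Rightarrow> nat) \<Rightarrow> real" where
  "EP_SM_prob \<alpha> \<theta> n x =
     (if (\<Sum>i=1..n. i * x i) = n
      then fact n * rising_ratio \<alpha> \<theta> (\<Sum>i=1..n. x i) n *
           (\<Prod>i=1..n. (\<alpha> * pochhammer (1 - \<alpha>) (i - 1) / fact i) ^ x i / fact (x i))
      else 0)"

text \<open>
  The boundary values (1 for n = j = 0, and 0 for j = 0 < n or j > n) are instances of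
  this formula.
\<close>

definition gen_fact_coeff :: "nat \<Rightarrow> nat \<Rightarrow> real \<Rightarrow> real" where
  "gen_fact_coeff n j \<alpha> =
     (1 / fact j) * (\<Sum>i=0..j. real (j choose i) * (- 1) ^ i * pochhammer (- (real i * \<alpha>)) n)"

definition NB_CPSM_prob :: "real \<Rightarrow> real \<Rightarrow> nat \<Rightarrow> (nat \<Rightarrow> nat) \<Rightarrow> real" where
  "NB_CPSM_prob \<alpha> z n x =
     (if (\<Sum>i=1..n. i * x i) = n
      then fact n / (\<Sum>j=0..n. gen_fact_coeff n j \<alpha> * z ^ j) *
           (\<Prod>i=1..n. (z * (\<alpha> * pochhammer (1 - \<alpha>) (i - 1) / fact i)) ^ x i / fact (x i))
      else 0)"

text \<open>
  The random vector (X 1, ..., X n) on the probability space P has joint probability mass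
  function p.
\<close>

definition has_joint_pmf ::
  "nat \<Rightarrow> 'a measure \<Rightarrow> (nat \<Rightarrow> 'a \<Rightarrow> nat) \<Rightarrow> ((nat \<Rightarrow> nat) \<Rightarrow> real) \<Rightarrow> bool" where
  "has_joint_pmf n P X p \<longleftrightarrow>
     prob_space P \<and>
     (\<forall>r\<in>{1..n}. X r \<in> measurable P (count_space UNIV)) \<and>
     (\<forall>x. measure P {\<omega> \<in> space P. \<forall>r\<in>{1..n}. X r \<omega> = x r} = p x)"

text \<open>
  The function f is (a version of) the density of the positive \<open>\<alpha>\<close>-stable law; the Laplace
  transform determines f up to a null set.
\<close>

definition positive_stable_density :: "real \<Rightarrow> (real \<Rightarrow> real) \<Rightarrow> bool" where
  "positive_stable_density \<alpha> f \<longleftrightarrow>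
     f \<in> borel_measurable borel \<and> (\<forall>x. 0 \<le> f x) \<and> (\<forall>x\<le>0. f x = 0) \<and>
     prob_space (density lborel f) \<and>
     (\<forall>t>0. (LINT x|density lborel f. exp (- t * x)) = exp (- (t powr \<alpha>)))"

definition scaled_ML_density :: "real \<Rightarrow> real \<Rightarrow> (real \<Rightarrow> real) \<Rightarrow> real \<Rightarrow> real" where
  "scaled_ML_density \<alpha> \<theta> f s =
     (if s > 0
      then Gamma (\<theta> + 1) / (\<alpha> * Gamma (\<theta> / \<alpha> + 1)) *
           s powr ((\<theta> - 1) / \<alpha> - 1) * f (s powr (- (1 / \<alpha>)))
      else 0)"

end

theory Submission
  imports Defs "HOL-Real_Asymp.Real_Asymp"
begin

text \<open>
  In both models the probability of a vector \<open>x\<close> is a factor depending only on the number of blocks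
  \<open>K = \<Sum>i. x i\<close>, times the weight \<open>\<Prod>i. w i ^ x i / (x i)!\<close>, where \<open>\<Sum>i. w i * t ^ i\<close> is
  \<open>W t = 1 - (1 - t) powr \<alpha>\<close>. With an additional factor \<open>u ^ K\<close> the weights sum to the coefficient of
  \<open>t ^ n\<close> in \<open>exp (u * W t)\<close> (\<open>partition_sum_eq_fps_exp\<close>), and both limits are read off from these
  coefficients.

  First limit. Let \<open>X\<close> be positive stable and \<open>v = c powr \<alpha>\<close>. Since
  \<open>exp (- v) * exp (v * W t) = exp (- (v * (1 - t) powr \<alpha>)) = E (exp (- (c * (1 - t) * X)))\<close>, the
  coefficient above is, up to \<open>exp (- v)\<close> and a factorial, the moment \<open>E ((c * X) ^ n * exp (- (c * X)))\<close>
  (\<open>stable_density_moment\<close>). Now let \<open>G\<close> be a variable that has, given \<open>K\<close>, the Gamma law with shape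
  \<open>\<theta> / \<alpha> + K\<close>. The normalisation of this law cancels the rising factorial in the Ewens-Pitman formula,
  so the density of \<open>G\<close> at \<open>v\<close> is a constant times \<open>v powr (\<theta> / \<alpha> - 1)\<close> times such a moment, with
  \<open>c = v powr (1 / \<alpha>)\<close>. A change of variables
  turns this into an exact identity in distribution, \<open>G = Y powr \<alpha> * S\<close>, with \<open>Y\<close> of Gamma law with
  shape \<open>\<theta> + n\<close>, independent of the scaled Mittag-Leffler variable \<open>S\<close> (\<open>gamma_mixture_identity\<close>).
  By Chebyshev's inequality \<open>Y / n\<close> tends to 1, so \<open>G / n powr \<alpha>\<close> tends to \<open>S\<close>
  (\<open>gamma_mixture_limit\<close>), and \<open>G\<close> differs from \<open>K\<close> by much less than \<open>n powr \<alpha>\<close>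
  (\<open>block_count_cdf_bounds\<close>).

  Second limit. Put \<open>a = - \<alpha>\<close> and \<open>y = - z\<close>, and let \<open>A n u\<close> be the coefficient of \<open>t ^ n\<close> in
  \<open>exp (u * ((1 - t) powr (- a) - 1))\<close>. As the probabilities sum to 1, \<open>E (s ^ K) = A n (s * y) / A n y\<close>
  (\<open>NB_CPSM_moment_generating\<close>). The logarithm of \<open>A n u\<close> grows like \<open>n powr (a / (1 + a))\<close> times
  \<open>(1 + 1 / a) * (a * u) powr (1 / (1 + a))\<close>: the upper bound evaluates the series at its saddle point
  (\<open>nb_coeff_upper_rate\<close>), and the lower bound keeps the dominant term of a Poisson mixture
  (\<open>nb_coeff_lower_rate\<close>). So the normalised logarithm of the moment generating function of \<open>K\<close> has a
  differentiable limit, and exponential tilting in the manner of Chernoff, Gaertner and Ellis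
  concentrates \<open>K / n powr (a / (1 + a))\<close> at its derivative at 0
  (\<open>exponential_moment_vanishes\<close>).
\<close>

section \<open>Weighted sums over partitions of an integer\<close>

text \<open>
  The bound \<open>N\<close> on the part sizes is separate from the sum \<open>n\<close>, because the recurrence below
  lowers \<open>n\<close> while the product over the part sizes stays the same. Entries outside \<open>{1..N}\<close> are
  zero, so that a vector is determined by its values on \<open>{1..N}\<close>.
\<close>

definition partition_vectors :: "nat \<Rightarrow> nat \<Rightarrow> (nat \<Rightarrow> nat) set" where
  "partition_vectors N n = {x. (\<forall>i. i \<notin> {1..N} \<longrightarrow> x i = 0) \<and> (\<Sum>i=1..N. i * x i) = n}"

definition weight :: "(nat \<Rightarrow> real) \<Rightarrow> nat \<Rightarrow> (nat \<Rightarrow> nat) \<Rightarrow> real" where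
  "weight g N x = (\<Prod>i=1..N. g i ^ x i / fact (x i))"

definition partition_sum :: "(nat \<Rightarrow> real) \<Rightarrow> nat \<Rightarrow> nat \<Rightarrow> real" where
  "partition_sum g N n = (\<Sum>x\<in>partition_vectors N n. weight g N x)"

lemma partition_vectors_le:
  assumes "x \<in> partition_vectors N n"
  shows "x i \<le> n"
proof (cases "i \<in> {1..N}")
  case True
  then have "x i \<le> i * x i" by simp
  also have "\<dots> \<le> (\<Sum>i=1..N. i * x i)"
    using True by (intro member_le_sum) auto
  finally show ?thesis using assms by (simp add: partition_vectors_def)
qed (use assms in \<open>auto simp: partition_vectors_def\<close>)

lemma finite_partition_vectors [simp]: "finite (partition_vectors N n)"
proof (rule finite_subset)
  show "partition_vectors N n \<subseteq> {x. \<forall>i. (i \<in> {1..N} \<longrightarrow> x i \<in> {0..n}) \<and> (i \<notin> {1..N} \<longrightarrow> x i = 0)}"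
    using partition_vectors_le by (fastforce simp: partition_vectors_def)
qed (intro finite_set_of_finite_funs, auto)

text \<open>
  Adding one part of size \<open>i\<close>; the inverse removes it.
\<close>

lemma bij_betw_partition_vectors_Suc:
  assumes i: "i \<in> {1..N}" and "i \<le> n"
  shows "bij_betw (\<lambda>y. y(i := Suc (y i))) (partition_vectors N (n - i))
           {x \<in> partition_vectors N n. x i > 0}"
proof -
  have split: "(\<Sum>j=1..N. j * x j) = i * x i + (\<Sum>j\<in>{1..N}-{i}. j * x j)" for x :: "nat \<Rightarrow> nat"
    using i by (subst sum.remove[of _ i]) auto
  have "(\<Sum>j\<in>{1..N}-{i}. j * (x(i := k)) j) = (\<Sum>j\<in>{1..N}-{i}. j * x j)" for x :: "nat \<Rightarrow> nat" and k
    by (intro sum.cong) auto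
  then have upd: "(\<Sum>j=1..N. j * (x(i := k)) j) = i * k + (\<Sum>j\<in>{1..N}-{i}. j * x j)" for x :: "nat \<Rightarrow> nat" and k
    by (simp only: split) simp
  show ?thesis
  proof (rule bij_betwI[where g = "\<lambda>x. x(i := x i - 1)"])
    show "(\<lambda>y. y(i := Suc (y i))) \<in> partition_vectors N (n - i) \<rightarrow> {x \<in> partition_vectors N n. x i > 0}"
      using assms by (auto simp: partition_vectors_def upd split simp del: fun_upd_apply One_nat_def)
         auto
    show "(\<lambda>x. x(i := x i - 1)) \<in> {x \<in> partition_vectors N n. x i > 0} \<rightarrow> partition_vectors N (n - i)"
      using assms by (auto simp: partition_vectors_def upd split simp del: fun_upd_apply One_nat_def
               dest!: gr0_implies_Suc) auto
  qed auto
qed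

lemma weight_Suc:
  assumes i: "i \<in> {1..N}"
  shows "real (Suc (y i)) * weight g N (y(i := Suc (y i))) = g i * weight g N y"
proof -
  have *: "weight g N x = g i ^ x i / fact (x i) * (\<Prod>j\<in>{1..N}-{i}. g j ^ x j / fact (x j))" for x
    unfolding weight_def using i by (subst prod.remove[of _ i]) auto
  have **: "(\<Prod>j\<in>{1..N}-{i}. g j ^ (y(i := Suc (y i))) j / fact ((y(i := Suc (y i))) j))
      = (\<Prod>j\<in>{1..N}-{i}. g j ^ y j / fact (y j))"
    by (intro prod.cong) auto
  show ?thesis
    unfolding *[of y] *[of "y(i := Suc (y i))"] **
    by (simp add: field_simps del: of_nat_Suc)
qed

text \<open>
  Write the factor \<open>n\<close> as \<open>\<Sum>i. i * x i\<close> and remove one part of size \<open>i\<close>. This is the coefficient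
  form of \<open>F' = F * G'\<close>, the equation solved by \<open>F = exp G\<close>.
\<close>

lemma partition_sum_recurrence:
  "real n * partition_sum g N n = (\<Sum>i\<in>{1..N} \<inter> {..n}. real i * g i * partition_sum g N (n - i))"
proof -
  have "real n * partition_sum g N n
      = (\<Sum>x\<in>partition_vectors N n. (\<Sum>i=1..N. real i * real (x i) * weight g N x))"
    unfolding partition_sum_def sum_distrib_left
  proof (rule sum.cong)
    fix x assume "x \<in> partition_vectors N n"
    then have "real n = (\<Sum>i=1..N. real i * real (x i))"
      by (auto simp: partition_vectors_def)
    then show "real n * weight g N x = (\<Sum>i=1..N. real i * real (x i) * weight g N x)"
      by (simp add: sum_distrib_right)
  qed simp
  also have "\<dots> = (\<Sum>i=1..N. real i * (\<Sum>x\<in>partition_vectors N n. real (x i) * weight g N x))"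
    by (subst sum.swap) (simp add: sum_distrib_left mult.assoc)
  also have "\<dots> = (\<Sum>i\<in>{1..N} \<inter> {..n}. real i * g i * partition_sum g N (n - i))"
  proof (rule sum.mono_neutral_cong_right)
    show "\<forall>i\<in>{1..N} - {1..N} \<inter> {..n}. real i * (\<Sum>x\<in>partition_vectors N n. real (x i) * weight g N x) = 0"
    proof
      fix i assume "i \<in> {1..N} - {1..N} \<inter> {..n}"
      then have i: "i \<in> {1..N}" "\<not> i \<le> n" by auto
      have "x i = 0" if "x \<in> partition_vectors N n" for x
      proof -
        have "i * x i \<le> (\<Sum>i=1..N. i * x i)"
          using i by (intro member_le_sum) auto
        then have "i * x i \<le> n" using that by (simp add: partition_vectors_def)
        then show ?thesis using i by (cases "x i") auto
      qed
      then show "real i * (\<Sum>x\<in>partition_vectors N n. real (x i) * weight g N x) = 0"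
        by (auto intro!: sum.neutral)
    qed
  next
    fix i assume i: "i \<in> {1..N} \<inter> {..n}"
    have "(\<Sum>x\<in>partition_vectors N n. real (x i) * weight g N x)
        = (\<Sum>x\<in>{x\<in>partition_vectors N n. x i > 0}. real (x i) * weight g N x)"
      by (intro sum.mono_neutral_right) auto
    also have "\<dots> = (\<Sum>y\<in>partition_vectors N (n - i). real (Suc (y i)) * weight g N (y(i := Suc (y i))))"
      using i by (subst sum.reindex_bij_betw[OF bij_betw_partition_vectors_Suc, symmetric]) auto
    also have "\<dots> = g i * partition_sum g N (n - i)"
      unfolding partition_sum_def sum_distrib_left using i by (intro sum.cong weight_Suc) auto
    finally show "real i * (\<Sum>x\<in>partition_vectors N n. real (x i) * weight g N x)
        = real i * g i * partition_sum g N (n - i)" by simp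
  qed auto
  finally show ?thesis .
qed

lemma partition_sum_0: "partition_sum g N 0 = 1"
proof -
  have "partition_vectors N 0 = {\<lambda>_. 0}"
    by (auto simp: partition_vectors_def fun_eq_iff) (metis atLeastAtMost_iff less_one not_less)
  then show ?thesis by (simp add: partition_sum_def weight_def)
qed

text \<open>
  The exponential formula: both sides satisfy the recurrence with the same initial value.
\<close>

lemma partition_sum_eq_fps_exp:
  assumes "fps_nth G 0 = 0" "n \<le> N"
  shows "partition_sum (fps_nth G) N n = fps_nth (fps_exp 1 oo G) n"
  using assms(2)
proof (induction n rule: less_induct)
  case (less n)
  let ?F = "fps_exp 1 oo G"
  show ?case
  proof (cases n)
    case 0
    then show ?thesis by (simp add: partition_sum_0)
  next
    case (Suc m)
    have "fps_deriv ?F = ?F * fps_deriv G"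
      using assms by (simp add: fps_compose_deriv)
    then have "fps_nth (fps_deriv ?F) m = (\<Sum>i=0..m. fps_nth (fps_deriv G) i * fps_nth ?F (m - i))"
      by (simp add: fps_mult_nth mult.commute[of ?F])
    then have "real n * fps_nth ?F n = (\<Sum>i=0..m. real (Suc i) * fps_nth G (Suc i) * fps_nth ?F (n - Suc i))"
      by (simp add: Suc add.commute)
    also have "\<dots> = (\<Sum>i\<in>{1..N} \<inter> {..n}. real i * fps_nth G i * fps_nth ?F (n - i))"
      using Suc less.prems
      by (intro sum.reindex_bij_witness[of _ "\<lambda>i. i - 1" Suc]) auto
    also have "\<dots> = (\<Sum>i\<in>{1..N} \<inter> {..n}. real i * fps_nth G i * partition_sum (fps_nth G) N (n - i))"
      using less by (intro sum.cong) auto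
    also have "\<dots> = real n * partition_sum (fps_nth G) N n"
      by (rule partition_sum_recurrence[symmetric])
    finally show ?thesis using Suc by simp
  qed
qed

section \<open>The law of the number of blocks\<close>

lemma countable_finite_support: "countable {x :: nat \<Rightarrow> nat. \<forall>i. i \<notin> {1..n} \<longrightarrow> x i = 0}"
proof (rule countable_subset)
  show "{x :: nat \<Rightarrow> nat. \<forall>i. i \<notin> {1..n} \<longrightarrow> x i = 0}
     \<subseteq> (\<lambda>g i. if i \<in> {1..n} then g i else 0) ` (PiE {1..n} (\<lambda>_. UNIV))"
  proof safe
    fix x :: "nat \<Rightarrow> nat" assume "\<forall>i. i \<notin> {1..n} \<longrightarrow> x i = 0"
    then have *: "x = (\<lambda>i. if i \<in> {1..n} then restrict x {1..n} i else 0)" by auto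
    show "x \<in> (\<lambda>g i. if i \<in> {1..n} then g i else 0) ` (PiE {1..n} (\<lambda>_. UNIV))"
      by (rule image_eqI[where x = "restrict x {1..n}"]) (use * in auto)
  qed
qed (intro countable_image countable_PiE, auto)

text \<open>
  Up to a null set the sample space is the disjoint union of the finitely many events on which the
  vector is some \<open>x\<close> with \<open>\<Sum>i. i * x i = n\<close>; the remaining values are countably many and have
  probability zero each.
\<close>

lemma measure_block_count:
  assumes pmf: "has_joint_pmf n P X p"
    and zero: "\<And>x. (\<Sum>i=1..n. i * x i) \<noteq> n \<Longrightarrow> p x = 0"
  shows "measure P {\<omega> \<in> space P. (\<Sum>r=1..n. X r \<omega>) \<in> B}
    = (\<Sum>x\<in>partition_vectors n n. if (\<Sum>i=1..n. x i) \<in> B then p x else 0)"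
proof -
  interpret prob_space P using pmf by (simp add: has_joint_pmf_def)
  have [measurable]: "X r \<in> measurable P (count_space UNIV)" if "r \<in> {1..n}" for r
    using pmf that by (auto simp: has_joint_pmf_def)
  define E where "E x = {\<omega> \<in> space P. \<forall>r\<in>{1..n}. X r \<omega> = x r}" for x
  have [measurable]: "E x \<in> sets P" for x unfolding E_def by measurable
  have prob_E: "prob (E x) = p x" for x
    using pmf by (simp add: has_joint_pmf_def E_def)
  define Z where "Z = {x :: nat \<Rightarrow> nat. \<forall>i. i \<notin> {1..n} \<longrightarrow> x i = 0}"
  define S where "S = {\<omega> \<in> space P. (\<Sum>r=1..n. X r \<omega>) \<in> B}"
  have S [measurable]: "S \<in> sets P"
  proof -
    have "(\<lambda>\<omega>. \<Sum>r=1..n. X r \<omega>) \<in> measurable P (count_space UNIV)"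
      by measurable
    then show ?thesis unfolding S_def by (rule measurable_sets_Collect) auto
  qed
  have cover: "\<exists>x\<in>Z. \<omega> \<in> E x" if "\<omega> \<in> space P" for \<omega>
    using that by (intro bexI[of _ "\<lambda>i. if i \<in> {1..n} then X i \<omega> else 0"]) (auto simp: E_def Z_def)
  have null: "(\<Union>x\<in>Z - partition_vectors n n. E x) \<in> null_sets P"
  proof (rule null_sets_UN')
    show "countable (Z - partition_vectors n n)"
      using countable_finite_support[of n] by (auto simp: Z_def intro: countable_subset)
    fix x assume "x \<in> Z - partition_vectors n n"
    then have "p x = 0" by (intro zero) (auto simp: Z_def partition_vectors_def)
    then show "E x \<in> null_sets P"
      using prob_E[of x] by (auto simp: null_sets_def emeasure_eq_measure)
  qed
  have "prob S = prob (\<Union>x\<in>partition_vectors n n. S \<inter> E x)"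
  proof (rule measure_eq_AE)
    show "AE \<omega> in P. (\<omega> \<in> S) = (\<omega> \<in> (\<Union>x\<in>partition_vectors n n. S \<inter> E x))"
      using AE_not_in[OF null] AE_space
    proof eventually_elim
      case (elim \<omega>)
      then show ?case using cover[of \<omega>] by blast
    qed
    show "(\<Union>x\<in>partition_vectors n n. S \<inter> E x) \<in> sets P"
      by (intro sets.finite_UN) auto
  qed auto
  also have "\<dots> = (\<Sum>x\<in>partition_vectors n n. prob (S \<inter> E x))"
  proof (rule finite_measure_finite_Union)
    show "disjoint_family_on (\<lambda>x. S \<inter> E x) (partition_vectors n n)"
      unfolding disjoint_family_on_def
    proof (intro ballI impI)
      fix x y assume xy: "x \<in> partition_vectors n n" "y \<in> partition_vectors n n" "x \<noteq> y"
      then obtain r where "x r \<noteq> y r" by auto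
      then have "r \<in> {1..n}" using xy by (auto simp: partition_vectors_def)
      then show "(S \<inter> E x) \<inter> (S \<inter> E y) = {}"
        using \<open>x r \<noteq> y r\<close> by (auto simp: E_def)
    qed
  qed auto
  also have "\<dots> = (\<Sum>x\<in>partition_vectors n n. if (\<Sum>i=1..n. x i) \<in> B then p x else 0)"
  proof (rule sum.cong)
    fix x
    have "(\<Sum>r=1..n. X r \<omega>) = (\<Sum>i=1..n. x i)" if "\<omega> \<in> E x" for \<omega>
      using that by (intro sum.cong) (auto simp: E_def)
    then have "S \<inter> E x = (if (\<Sum>i=1..n. x i) \<in> B then E x else {})"
      by (auto simp: S_def E_def)
    then show "prob (S \<inter> E x) = (if (\<Sum>i=1..n. x i) \<in> B then p x else 0)"
      by (simp add: prob_E)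
  qed simp
  finally show ?thesis by (simp add: S_def)
qed

lemma cdf_block_count:
  assumes pmf: "has_joint_pmf n P X p"
    and zero: "\<And>x. (\<Sum>i=1..n. i * x i) \<noteq> n \<Longrightarrow> p x = 0"
    and c: "c > 0"
  shows "cdf (distr P borel (\<lambda>\<omega>. real (\<Sum>r=1..n. X r \<omega>) / c)) y
    = (\<Sum>x\<in>partition_vectors n n. if real (\<Sum>i=1..n. x i) \<le> c * y then p x else 0)"
proof -
  have [measurable]: "X r \<in> measurable P (count_space UNIV)" if "r \<in> {1..n}" for r
    using pmf that by (auto simp: has_joint_pmf_def)
  have "cdf (distr P borel (\<lambda>\<omega>. real (\<Sum>r=1..n. X r \<omega>) / c)) y
    = measure P {\<omega> \<in> space P. real (\<Sum>r=1..n. X r \<omega>) / c \<le> y}"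
    unfolding cdf_def
    by (subst measure_distr) (auto intro!: arg_cong[of _ _ "measure P"])
  also have "\<dots> = measure P {\<omega> \<in> space P. (\<Sum>r=1..n. X r \<omega>) \<in> {k. real k \<le> c * y}}"
    using c by (simp add: field_simps)
  also have "\<dots> = (\<Sum>x\<in>partition_vectors n n. if (\<Sum>i=1..n. x i) \<in> {k. real k \<le> c * y} then p x else 0)"
    by (rule measure_block_count[OF pmf zero])
  finally show ?thesis by simp
qed

lemma sum_joint_pmf_eq_1:
  assumes pmf: "has_joint_pmf n P X p"
    and zero: "\<And>x. (\<Sum>i=1..n. i * x i) \<noteq> n \<Longrightarrow> p x = 0"
  shows "(\<Sum>x\<in>partition_vectors n n. p x) = 1"
proof -
  interpret prob_space P using pmf by (simp add: has_joint_pmf_def)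
  show ?thesis
    using measure_block_count[OF pmf zero, of UNIV] by (simp add: prob_space)
qed

section \<open>Real power series\<close>

text \<open>
  The lowest nonzero coefficient of the difference would be the limit of a function that vanishes
  near 0.
\<close>

lemma has_fps_expansion_unique_real:
  fixes F G :: "real fps"
  assumes F: "f has_fps_expansion F" and G: "f has_fps_expansion G"
  shows "F = G"
proof -
  have H: "(\<lambda>x. f x - f x) has_fps_expansion F - G"
    using F G by (intro has_fps_expansion_diff)
  then have R: "fps_conv_radius (F - G) > 0"
    and ev: "eventually (\<lambda>z. eval_fps (F - G) z = 0) (nhds 0)"
    by (auto simp: has_fps_expansion_def)
  obtain r where r: "r > 0" "ereal r \<le> fps_conv_radius (F - G)"
  proof -
    obtain r where "0 < ereal r" "ereal r < fps_conv_radius (F - G)"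
      using ereal_dense2[OF R] by blast
    then show ?thesis using that[of r] by simp
  qed
  obtain e where e: "e > 0" "\<And>z. norm z < e \<Longrightarrow> eval_fps (F - G) z = 0"
    using ev by (auto simp: eventually_nhds_metric dist_norm)
  have sums: "(\<lambda>n. fps_nth (F - G) n * z ^ n) sums 0" if "norm z < min r e" for z
  proof -
    have "summable (\<lambda>n. fps_nth (F - G) n * z ^ n)"
      using that r by (intro summable_fps) (auto intro: less_le_trans[of _ "ereal r"])
    then have "(\<lambda>n. fps_nth (F - G) n * z ^ n) sums eval_fps (F - G) z"
      unfolding eval_fps_def by (rule summable_sums)
    then show ?thesis using e(2)[of z] that by simp
  qed
  have "fps_nth (F - G) n = 0" for n
  proof (induction n rule: less_induct)
    case (less n)
    have "((\<lambda>_::real. 0 :: real) \<longlongrightarrow> fps_nth (F - G) (0 + n)) (at 0)"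
    proof (rule powser_limit_0_strong[of "min r e" "\<lambda>m. fps_nth (F - G) (m + n)"])
      fix x :: real assume x: "x \<noteq> 0" "norm x < min r e"
      have "(\<lambda>m. fps_nth (F - G) (m + n) * x ^ (m + n)) sums 0"
        using sums[OF x(2)] less by (subst sums_iff_shift) auto
      then have "(\<lambda>m. fps_nth (F - G) (m + n) * x ^ (m + n) * inverse (x ^ n)) sums (0 * inverse (x ^ n))"
        by (rule sums_mult2)
      then show "(\<lambda>m. fps_nth (F - G) (m + n) * x ^ m) sums 0"
        using x by (simp add: power_add mult.assoc del: fps_sub_nth)
    qed (use r e in auto)
    then have "0 = fps_nth (F - G) (0 + n)" by (rule LIM_const_eq)
    then show ?case by simp
  qed
  then show ?thesis by (simp add: fps_eq_iff)
qed

lemma has_fps_expansion_sums: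
  fixes a :: "nat \<Rightarrow> real"
  assumes "\<And>t. \<bar>t\<bar> < 1 \<Longrightarrow> (\<lambda>n. a n * t ^ n) sums f t"
  shows "f has_fps_expansion Abs_fps a"
  unfolding has_fps_expansion_def
proof
  have "ereal (norm (1/2 :: real)) \<le> conv_radius a"
    using sums_summable[OF assms[of "1/2"]] by (intro conv_radius_geI) simp
  then show "0 < fps_conv_radius (Abs_fps a)"
    unfolding fps_conv_radius_def fps_nth_Abs_fps
    by (rule less_le_trans[rotated]) simp
  have "eventually (\<lambda>t::real. t \<in> {-1<..<1}) (nhds 0)"
    by (intro eventually_nhds_in_open) auto
  then show "eventually (\<lambda>t. eval_fps (Abs_fps a) t = f t) (nhds 0)"
  proof eventually_elim
    case (elim t)
    then show ?case using assms[of t] by (simp add: eval_fps_def sums_iff abs_if)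
  qed
qed

text \<open>
  The difference solves a homogeneous equation that determines each coefficient from the previous
  ones, starting from 0.
\<close>

lemma fps_linear_ODE_unique:
  fixes F G D :: "real fps"
  assumes "fps_deriv F = F * D" "fps_deriv G = G * D" "fps_nth F 0 = c * fps_nth G 0"
  shows "F = fps_const c * G"
proof -
  define H where "H = F - fps_const c * G"
  have dH: "fps_deriv H = H * D" and H0: "fps_nth H 0 = 0"
    using assms by (simp_all add: H_def algebra_simps)
  have "fps_nth H n = 0" for n
  proof (induction n rule: less_induct)
    case (less n)
    show ?case
    proof (cases n)
      case (Suc m)
      have "real n * fps_nth H n = fps_nth (fps_deriv H) m"
        using Suc by simp
      also have "\<dots> = (\<Sum>i=0..m. fps_nth H i * fps_nth D (m - i))"
        by (simp add: dH fps_mult_nth)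
      also have "\<dots> = 0"
        using less Suc by (intro sum.neutral) auto
      finally show ?thesis using Suc by simp
    qed (simp add: H0)
  qed
  then have "H = 0" by (simp add: fps_eq_iff)
  then show ?thesis by (simp add: H_def)
qed

section \<open>The block weights and the stable law\<close>

text \<open>
  The expansion of \<open>1 - (1 - t) powr \<alpha>\<close>. For \<open>0 < \<alpha> < 1\<close> it is the probability generating
  function of the Sibuya law; its coefficients are the weights of the blocks in both models.
\<close>

definition sibuya_fps :: "real \<Rightarrow> real fps" where
  "sibuya_fps \<alpha> = Abs_fps (\<lambda>i. if i = 0 then 0 else - pochhammer (- \<alpha>) i / fact i)"

lemma sibuya_fps_nth:
  "i \<ge> 1 \<Longrightarrow> fps_nth (sibuya_fps \<alpha>) i = \<alpha> * pochhammer (1 - \<alpha>) (i - 1) / fact i"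
  by (cases i) (auto simp: sibuya_fps_def pochhammer_rec)

lemma sibuya_fps_nth_0 [simp]: "fps_nth (sibuya_fps \<alpha>) 0 = 0"
  by (simp add: sibuya_fps_def)

lemma pochhammer_sums:
  fixes t :: real
  assumes "\<bar>t\<bar> < 1"
  shows "(\<lambda>n. pochhammer (- a) n / fact n * t ^ n) sums (1 - t) powr a"
proof -
  have "(\<lambda>n. (a gchoose n) * (- t) ^ n) sums (1 + (- t)) powr a"
    using assms by (intro gen_binomial_real) auto
  also have "(\<lambda>n. (a gchoose n) * (- t) ^ n) = (\<lambda>n. pochhammer (- a) n / fact n * t ^ n)"
  proof
    fix n
    have "(- 1) ^ n * (- t) ^ n = t ^ n"
      by (subst power_mult_distrib[symmetric]) simp
    then show "(a gchoose n) * (- t) ^ n = pochhammer (- a) n / fact n * t ^ n"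
      by (simp add: gbinomial_pochhammer mult_ac)
  qed
  finally show ?thesis by simp
qed

lemma sibuya_fps_sums:
  assumes "\<bar>t\<bar> < 1"
  shows "(\<lambda>n. fps_nth (sibuya_fps \<alpha>) n * t ^ n) sums (1 - (1 - t) powr \<alpha>)"
proof -
  have "(\<lambda>n. (if n = 0 then 1 else 0) * t ^ n) sums 1"
    using powser_sums_if[of 0 t] by simp
  then have "(\<lambda>n. (if n = 0 then 1 else 0) * t ^ n - pochhammer (- \<alpha>) n / fact n * t ^ n) sums (1 - (1 - t) powr \<alpha>)"
    using assms by (intro sums_diff pochhammer_sums)
  also have "(\<lambda>n. (if n = 0 then 1 else 0) * t ^ n - pochhammer (- \<alpha>) n / fact n * t ^ n)
     = (\<lambda>n. fps_nth (sibuya_fps \<alpha>) n * t ^ n)"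
    by (auto simp: sibuya_fps_def)
  finally show ?thesis .
qed

text \<open>
  Substituting one convergent series into another is avoided by means of a differential equation:
  \<open>Q t = exp (- (v * (1 - t) powr \<alpha>))\<close> satisfies \<open>Q' = Q * v * W'\<close> for the function \<open>W\<close> of
  \<open>sibuya_fps \<alpha>\<close>, and so does the formal exponential.
\<close>

lemma exp_sibuya_expansion_unique:
  assumes sums: "\<And>t. \<bar>t\<bar> < 1 \<Longrightarrow> (\<lambda>n. q n * t ^ n) sums exp (- (v * (1 - t) powr \<alpha>))"
  shows "q n = exp (- v) * fps_nth (fps_exp 1 oo (fps_const v * sibuya_fps \<alpha>)) n"
proof -
  define Q where "Q = (\<lambda>t. exp (- (v * (1 - t) powr \<alpha>)))"
  define F where "F = Abs_fps q"
  have F: "Q has_fps_expansion F"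
    unfolding Q_def F_def by (rule has_fps_expansion_sums) (rule sums)
  have W: "(\<lambda>t. 1 - (1 - t) powr \<alpha>) has_fps_expansion sibuya_fps \<alpha>"
    using has_fps_expansion_sums[OF sibuya_fps_sums] by (simp add: fps_nth_inverse)
  define w where "w = (\<lambda>t::real. \<alpha> * (1 - t) powr (\<alpha> - 1))"
  have near: "eventually (\<lambda>t::real. t \<in> {-1<..<1}) (nhds 0)"
    by (intro eventually_nhds_in_open) auto
  have dW: "w has_fps_expansion fps_deriv (sibuya_fps \<alpha>)"
  proof -
    have "eventually (\<lambda>t. deriv (\<lambda>t. 1 - (1 - t) powr \<alpha>) t = w t) (nhds 0)"
      using near
    proof eventually_elim
      case (elim t)
      then have "((\<lambda>t. 1 - (1 - t) powr \<alpha>) has_real_derivative w t) (at t)"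
        unfolding w_def by (auto intro!: derivative_eq_intros)
      then show ?case by (rule DERIV_imp_deriv)
    qed
    with has_fps_expansion_deriv[OF W] show ?thesis
      by (simp add: has_fps_expansion_def) (auto elim: eventually_elim2)
  qed
  have dF: "(\<lambda>t. Q t * (v * w t)) has_fps_expansion fps_deriv F"
  proof -
    have "eventually (\<lambda>t. deriv Q t = Q t * (v * w t)) (nhds 0)"
      using near
    proof eventually_elim
      case (elim t)
      then have "(Q has_real_derivative Q t * (v * w t)) (at t)"
        unfolding w_def Q_def by (auto intro!: derivative_eq_intros)
      then show ?case by (rule DERIV_imp_deriv)
    qed
    with has_fps_expansion_deriv[OF F] show ?thesis
      by (simp add: has_fps_expansion_def) (auto elim: eventually_elim2)
  qed
  have "(\<lambda>t. Q t * (v * w t)) has_fps_expansion F * (fps_const v * fps_deriv (sibuya_fps \<alpha>))"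
    by (intro has_fps_expansion_mult has_fps_expansion_cmult_left F dW)
  then have "fps_deriv F = F * fps_deriv (fps_const v * sibuya_fps \<alpha>)"
    using has_fps_expansion_unique_real[OF dF] by simp
  moreover have "fps_nth F 0 = exp (- v)"
  proof -
    have "(\<lambda>n. q n * 0 ^ n) sums q 0" by (rule powser_sums_zero)
    with sums[of 0] have "q 0 = exp (- (v * (1 - 0) powr \<alpha>))"
      using sums_unique2 by fastforce
    then show ?thesis by (simp add: F_def)
  qed
  ultimately have "F = fps_const (exp (- v)) * (fps_exp 1 oo (fps_const v * sibuya_fps \<alpha>))"
    by (intro fps_linear_ODE_unique[where D = "fps_deriv (fps_const v * sibuya_fps \<alpha>)"])
       (simp_all add: fps_compose_deriv)
  then show ?thesis by (simp add: F_def fps_eq_iff)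
qed

text \<open>
  For stable \<open>X\<close>, expand \<open>E (exp (- (c * (1 - t) * X))) = exp (- (c powr \<alpha> * (1 - t) powr \<alpha>))\<close> in
  powers of \<open>t\<close>. On the left the coefficients are \<open>E ((c * X) ^ n * exp (- (c * X))) / n!\<close>, and on the
  right they are those of \<open>exp (- v) * exp (v * W)\<close> with \<open>v = c powr \<alpha>\<close> and \<open>W t = 1 - (1 - t) powr \<alpha>\<close>.
\<close>

lemma stable_density_moment:
  assumes f: "positive_stable_density \<alpha> f" and c: "c > 0"
  shows "(\<integral>\<^sup>+x. ennreal ((c * x) ^ n * exp (- (c * x)) * f x) \<partial>lborel)
    = ennreal (fact n * exp (- (c powr \<alpha>)) *
        fps_nth (fps_exp 1 oo (fps_const (c powr \<alpha>) * sibuya_fps \<alpha>)) n)"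
proof -
  define \<mu> where "\<mu> = density lborel (\<lambda>x. ennreal (f x))"
  have [measurable]: "f \<in> borel_measurable borel" and f0: "f x \<ge> 0" "x \<le> 0 \<Longrightarrow> f x = 0" for x
    using f by (auto simp: positive_stable_density_def)
  have lap: "(LINT x|\<mu>. exp (- t * x)) = exp (- (t powr \<alpha>))" if "t > 0" for t
    using f that by (simp add: positive_stable_density_def \<mu>_def)
  interpret prob_space \<mu> using f by (simp add: positive_stable_density_def \<mu>_def)
  have pos: "AE x in \<mu>. x > 0"
    unfolding \<mu>_def 
  proof (subst AE_density)
    show "AE x in lborel. 0 < ennreal (f x) \<longrightarrow> 0 < x"
      using f0(2) by (intro AE_I2) (metis ennreal_0 less_irrefl not_le)
  qed auto
  have [simp]: "sets \<mu> = sets borel" by (simp add: \<mu>_def)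
  have [measurable_cong]: "sets \<mu> = sets borel" by (simp add: \<mu>_def)
  define \<phi> where "\<phi> n x = (c * x) ^ n * exp (- (c * x)) / fact n" for n and x :: real
  have [measurable]: "\<phi> n \<in> borel_measurable borel" for n unfolding \<phi>_def[abs_def] by measurable
  have int: "integrable \<mu> (\<phi> n)" for n
  proof (rule integrable_const_bound[where B = 1])
    show "AE x in \<mu>. norm (\<phi> n x) \<le> 1"
      using pos
    proof eventually_elim
      case (elim x)
      have "(c * x) ^ n / fact n \<le> exp (c * x)"
        using exp_converges[of "c * x"] sum_le_suminf[of "\<lambda>i. (c * x) ^ i / fact i" "{n}"] c elim
        by (simp add: sums_iff divide_inverse mult.commute)
      then show ?case
        using c elim by (simp add: \<phi>_def exp_minus field_simps)
    qed
  qed auto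
  have sums: "(\<lambda>n. (LINT x|\<mu>. \<phi> n x) * t ^ n) sums exp (- (c powr \<alpha> * (1 - t) powr \<alpha>))" if t: "\<bar>t\<bar> < 1" for t
  proof -
    have series: "(\<lambda>n. \<phi> n x * s ^ n) sums exp (- (c * (1 - s)) * x)" for x s
    proof -
      have "(\<lambda>n. exp (- (c * x)) * ((s * c * x) ^ n /\<^sub>R fact n)) sums (exp (- (c * x)) * exp (s * c * x))"
        by (intro sums_mult exp_converges)
      also have "exp (- (c * x)) * exp (s * c * x) = exp (- (c * (1 - s)) * x)"
        by (simp flip: exp_add add: algebra_simps)
      also have "(\<lambda>n. exp (- (c * x)) * ((s * c * x) ^ n /\<^sub>R fact n)) = (\<lambda>n. \<phi> n x * s ^ n)"
        by (auto simp: \<phi>_def power_mult_distrib field_simps)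
      finally show ?thesis .
    qed
    have "(\<lambda>n. LINT x|\<mu>. \<phi> n x * t ^ n) sums (LINT x|\<mu>. (\<Sum>n. \<phi> n x * t ^ n))"
    proof (rule sums_integral)
      show "integrable \<mu> (\<lambda>x. \<phi> n x * t ^ n)" for n using int by simp
      show "AE x in \<mu>. summable (\<lambda>n. norm (\<phi> n x * t ^ n))"
        using pos
      proof eventually_elim
        case (elim x)
        have "norm (\<phi> n x * t ^ n) = \<phi> n x * \<bar>t\<bar> ^ n" for n
          using elim c by (auto simp: \<phi>_def abs_mult power_abs)
        then show ?case using sums_summable[OF series[of x "\<bar>t\<bar>"]] by simp
      qed
      show "summable (\<lambda>n. LINT x|\<mu>. norm (\<phi> n x * t ^ n))"
      proof (rule summableI_nonneg_bounded[where x = 1])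
        fix N
        have "(\<Sum>n<N. LINT x|\<mu>. norm (\<phi> n x * t ^ n)) = (LINT x|\<mu>. (\<Sum>n<N. norm (\<phi> n x * t ^ n)))"
          using int by (intro Bochner_Integration.integral_sum[symmetric]) auto
        also have "\<dots> \<le> (LINT x|\<mu>. 1)"
        proof (rule integral_mono_AE)
          show "AE x in \<mu>. (\<Sum>n<N. norm (\<phi> n x * t ^ n)) \<le> 1"
            using pos
          proof eventually_elim
            case (elim x)
            have "norm (\<phi> n x * t ^ n) = \<phi> n x * \<bar>t\<bar> ^ n" for n
              using elim c by (auto simp: \<phi>_def abs_mult power_abs)
            then have "(\<Sum>n<N. norm (\<phi> n x * t ^ n)) = (\<Sum>n<N. \<phi> n x * \<bar>t\<bar> ^ n)"
              by simp
            also have "\<dots> \<le> exp (- (c * (1 - \<bar>t\<bar>)) * x)"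
              using series[of x "\<bar>t\<bar>"] elim c
              by (intro sum_le_suminf[THEN order_trans]) (auto simp: sums_iff \<phi>_def)
            also have "\<dots> \<le> 1" using elim c t by simp
            finally show ?case .
          qed
        qed (use int in auto)
        also have "\<dots> = 1" by (simp add: prob_space)
        finally show "(\<Sum>n<N. LINT x|\<mu>. norm (\<phi> n x * t ^ n)) \<le> 1" .
      qed (auto intro: integral_nonneg_AE)
    qed
    also have "(LINT x|\<mu>. (\<Sum>n. \<phi> n x * t ^ n)) = (LINT x|\<mu>. exp (- (c * (1 - t)) * x))"
      using series by (simp add: sums_iff)
    also have "\<dots> = exp (- ((c * (1 - t)) powr \<alpha>))"
      using c t by (intro lap) auto
    finally show ?thesis
      using c t by (simp add: powr_mult)
  qed
  have "(LINT x|\<mu>. \<phi> n x) = exp (- (c powr \<alpha>)) * fps_nth (fps_exp 1 oo (fps_const (c powr \<alpha>) * sibuya_fps \<alpha>)) n"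
    by (rule exp_sibuya_expansion_unique) (rule sums)
  moreover have "(\<integral>\<^sup>+x. ennreal (\<phi> n x) \<partial>\<mu>) = ennreal (LINT x|\<mu>. \<phi> n x)"
  proof (rule nn_integral_eq_integral[OF int])
    show "AE x in \<mu>. 0 \<le> \<phi> n x"
      using pos by eventually_elim (use c in \<open>auto simp: \<phi>_def\<close>)
  qed
  moreover have "(\<integral>\<^sup>+x. ennreal ((c * x) ^ n * exp (- (c * x)) * f x) \<partial>lborel)
      = ennreal (fact n) * (\<integral>\<^sup>+x. ennreal (\<phi> n x) \<partial>\<mu>)"
  proof -
    have "(\<integral>\<^sup>+x. ennreal (\<phi> n x) \<partial>\<mu>) = (\<integral>\<^sup>+x. ennreal (f x) * ennreal (\<phi> n x) \<partial>lborel)"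
      unfolding \<mu>_def by (subst nn_integral_density) auto
    moreover have "(\<integral>\<^sup>+x. ennreal ((c * x) ^ n * exp (- (c * x)) * f x) \<partial>lborel)
        = (\<integral>\<^sup>+x. ennreal (fact n) * (ennreal (f x) * ennreal (\<phi> n x)) \<partial>lborel)"
    proof (intro nn_integral_cong)
      fix x :: real
      show "ennreal ((c * x) ^ n * exp (- (c * x)) * f x) = ennreal (fact n) * (ennreal (f x) * ennreal (\<phi> n x))"
      proof (cases "x > 0")
        case True
        have *: "(c * x) ^ n * exp (- (c * x)) * f x = fact n * (f x * \<phi> n x)"
          by (simp add: \<phi>_def)
        show ?thesis unfolding * using f0(1)[of x] by (simp add: ennreal_mult')
      qed (use f0(2) in auto)
    qed
    ultimately show ?thesis by (simp add: nn_integral_cmult)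
  qed
  ultimately show ?thesis
    by (simp add: mult.assoc flip: ennreal_mult')
qed

section \<open>Substitution and Gamma laws\<close>

lemma SUP_mult_indicator:
  "(SUP m. (h :: ennreal) * indicator (A m) x) = h * indicator (\<Union>m. A m) x"
proof (cases "x \<in> (\<Union>m. A m)")
  case True
  then obtain m where "x \<in> A m" by blast
  then have "h \<le> (SUP m. h * indicator (A m) x)"
    by (intro SUP_upper2[of m]) auto
  moreover have "(SUP m. h * indicator (A m) x) \<le> h"
    by (intro SUP_least) (auto split: split_indicator)
  ultimately show ?thesis using True by simp
qed auto

text \<open>
  Exhaust the line by bounded intervals, on which the substitution rule for monotone functions
  applies.
\<close>

lemma nn_integral_exp_substitution:
  fixes f :: "real \<Rightarrow> ennreal"
  assumes [measurable]: "f \<in> borel_measurable borel"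
  shows "(\<integral>\<^sup>+x. f x * indicator {0<..} x \<partial>lborel) = (\<integral>\<^sup>+u. f (exp u) * ennreal (exp u) \<partial>lborel)"
proof -
  let ?I = "\<lambda>m::nat. {- real m - 1..real m + 1}"
  let ?J = "\<lambda>m::nat. {exp (- real m - 1)..exp (real m + 1)}"
  have UI: "(\<Union>m. ?I m) = UNIV"
  proof safe
    fix x :: real
    obtain m :: nat where "\<bar>x\<bar> \<le> real m" using real_arch_simple by blast
    then show "x \<in> (\<Union>m. ?I m)" by (auto intro!: exI[of _ m])
  qed auto
  have UJ: "(\<Union>m. ?J m) = {0<..}"
  proof (intro equalityI subsetI)
    fix x :: real assume "x \<in> {0<..}"
    then have x: "x > 0" by simp
    obtain m where "ln x \<in> ?I m" using UI by blast
    then have "exp (ln x) \<in> ?J m" by (simp del: exp_ln)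
    then show "x \<in> (\<Union>m. ?J m)" using x by auto
  qed (auto intro: less_le_trans[OF exp_gt_zero])
  have J_mono: "?J m \<subseteq> ?J n" if "m \<le> n" for m n
    using that by auto
  have "(\<integral>\<^sup>+x. f x * indicator {0<..} x \<partial>lborel) = (\<integral>\<^sup>+x. (SUP m. f x * indicator (?J m) x) \<partial>lborel)"
    unfolding SUP_mult_indicator UJ ..
  also have "\<dots> = (SUP m. \<integral>\<^sup>+x. f x * indicator (?J m) x \<partial>lborel)"
    by (intro nn_integral_monotone_convergence_SUP)
       (auto simp: incseq_def le_fun_def intro!: mult_left_mono indicator_leI dest: subsetD[OF J_mono])
  also have "\<dots> = (SUP m. \<integral>\<^sup>+u. f (exp u) * ennreal (exp u) * indicator (?I m) u \<partial>lborel)"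
    by (intro SUP_cong refl nn_integral_substitution_aux) (auto intro!: derivative_eq_intros continuous_intros)
  also have "\<dots> = (\<integral>\<^sup>+u. (SUP m. f (exp u) * ennreal (exp u) * indicator (?I m) u) \<partial>lborel)"
    by (intro nn_integral_monotone_convergence_SUP[symmetric])
       (auto simp: incseq_def le_fun_def intro!: mult_left_mono split: split_indicator)
  also have "\<dots> = (\<integral>\<^sup>+u. f (exp u) * ennreal (exp u) \<partial>lborel)"
    unfolding SUP_mult_indicator UI by simp
  finally show ?thesis .
qed

text \<open>
  In the logarithmic coordinate a power map is affine, so exponents of either sign are covered at
  once.
\<close>

lemma nn_integral_powr_substitution:
  fixes f :: "real \<Rightarrow> ennreal"
  assumes [measurable]: "f \<in> borel_measurable borel" and c: "c > 0" and p: "p \<noteq> 0"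
  shows "(\<integral>\<^sup>+x. f x * indicator {0<..} x \<partial>lborel)
    = (\<integral>\<^sup>+s. f (c * s powr p) * ennreal (\<bar>p\<bar> * c * s powr (p - 1)) * indicator {0<..} s \<partial>lborel)"
proof -
  have "(\<integral>\<^sup>+x. f x * indicator {0<..} x \<partial>lborel) = (\<integral>\<^sup>+u. f (exp u) * ennreal (exp u) \<partial>lborel)"
    by (rule nn_integral_exp_substitution) fact
  also have "\<dots> = \<bar>p\<bar> * (\<integral>\<^sup>+u. f (exp (ln c + p * u)) * ennreal (exp (ln c + p * u)) \<partial>lborel)"
    using p by (subst nn_integral_real_affine[of _ p "ln c"]) auto
  also have "\<dots> = (\<integral>\<^sup>+u. \<bar>p\<bar> * (f (exp (ln c + p * u)) * ennreal (exp (ln c + p * u))) \<partial>lborel)"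
    by (subst nn_integral_cmult) auto
  also have "\<dots> = (\<integral>\<^sup>+u. f (c * exp u powr p) * ennreal (\<bar>p\<bar> * c * exp u powr (p - 1)) * ennreal (exp u) \<partial>lborel)"
  proof (intro nn_integral_cong)
    fix u :: real
    have e: "exp (ln c + p * u) = c * exp u powr p"
      using c by (simp add: exp_add powr_def mult.commute)
    have "\<bar>p\<bar> * exp (ln c + p * u) = \<bar>p\<bar> * c * exp u powr (p - 1) * exp u"
      using c by (simp add: exp_add powr_def algebra_simps exp_diff)
    then have e2: "ennreal \<bar>p\<bar> * ennreal (exp (ln c + p * u)) = ennreal (\<bar>p\<bar> * c * exp u powr (p - 1)) * ennreal (exp u)"
      using c by (simp flip: ennreal_mult)
    have "ennreal \<bar>p\<bar> * (f (exp (ln c + p * u)) * ennreal (exp (ln c + p * u)))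
      = f (exp (ln c + p * u)) * (ennreal \<bar>p\<bar> * ennreal (exp (ln c + p * u)))"
      by (simp add: mult_ac)
    also have "\<dots> = f (c * exp u powr p) * ennreal (\<bar>p\<bar> * c * exp u powr (p - 1)) * ennreal (exp u)"
      unfolding e2 unfolding e by (simp add: mult_ac)
    finally show "ennreal \<bar>p\<bar> * (f (exp (ln c + p * u)) * ennreal (exp (ln c + p * u)))
      = f (c * exp u powr p) * ennreal (\<bar>p\<bar> * c * exp u powr (p - 1)) * ennreal (exp u)" .
  qed
  also have "\<dots> = (\<integral>\<^sup>+s. f (c * s powr p) * ennreal (\<bar>p\<bar> * c * s powr (p - 1)) * indicator {0<..} s \<partial>lborel)"
    by (subst nn_integral_exp_substitution) auto
  finally show ?thesis .
qed

definition gamma_density :: "real \<Rightarrow> real \<Rightarrow> real" where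
  "gamma_density k v = (if v > 0 then v powr (k - 1) * exp (- v) / Gamma k else 0)"

lemma gamma_density_nonneg: "k > 0 \<Longrightarrow> gamma_density k v \<ge> 0"
  by (simp add: gamma_density_def Gamma_real_pos less_imp_le)

lemma borel_measurable_gamma_density [measurable]: "gamma_density k \<in> borel_measurable borel"
  unfolding gamma_density_def[abs_def] by measurable

lemma nn_integral_gamma_density:
  assumes "k > 0"
  shows "(\<integral>\<^sup>+v. ennreal (gamma_density k v) \<partial>lborel) = 1"
proof -
  have "(\<integral>\<^sup>+v. ennreal (gamma_density k v) \<partial>lborel)
      = (\<integral>\<^sup>+v. ennreal (1 / Gamma k) * ennreal (indicator {0..} v * v powr (k - 1) / exp v) \<partial>lborel)"
  proof (intro nn_integral_cong_AE)
    show "AE v in lborel. ennreal (gamma_density k v)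
      = ennreal (1 / Gamma k) * ennreal (indicator {0..} v * v powr (k - 1) / exp v)"
      using AE_lborel_singleton[of 0]
    proof eventually_elim
      case (elim v)
      have "gamma_density k v = (1 / Gamma k) * (indicator {0..} v * v powr (k - 1) / exp v)"
        using elim by (auto simp: gamma_density_def exp_minus field_simps indicator_def)
      then show ?case
        using assms by (simp only: ennreal_mult' Gamma_real_pos less_imp_le zero_le_divide_1_iff)
    qed
  qed
  also have "\<dots> = ennreal (1 / Gamma k) * ennreal (Gamma k)"
    using assms by (subst nn_integral_cmult) (auto simp: Gamma_conv_nn_integral_real)
  also have "\<dots> = 1"
    using Gamma_real_pos[OF assms] by (simp add: less_imp_le less_imp_neq[symmetric] flip: ennreal_mult)
  finally show ?thesis .
qed

definition gamma_law :: "real \<Rightarrow> real measure" where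
  "gamma_law k = density lborel (\<lambda>v. ennreal (gamma_density k v))"

lemma sets_gamma_law [measurable_cong, simp]: "sets (gamma_law k) = sets borel"
  by (simp add: gamma_law_def)

lemma space_gamma_law [simp]: "space (gamma_law k) = UNIV"
  by (simp add: gamma_law_def)

lemma prob_space_gamma_law: "k > 0 \<Longrightarrow> prob_space (gamma_law k)"
  by (intro prob_spaceI) (simp add: gamma_law_def emeasure_density nn_integral_gamma_density)

lemma Gamma_plus1_real: "(k::real) > 0 \<Longrightarrow> Gamma (k + 1) = k * Gamma k"
  by (rule Gamma_plus1) auto

lemma has_bochner_integral_gamma_density:
  assumes "k > 0"
  shows "has_bochner_integral lborel (gamma_density k) 1"
  using assms by (intro has_bochner_integral_nn_integral) 
    (auto simp: gamma_density_nonneg nn_integral_gamma_density)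

lemma gamma_density_Suc:
  assumes "k > 0"
  shows "gamma_density k v * v = k * gamma_density (k + 1) v"
  using assms Gamma_real_pos[OF assms] Gamma_plus1_real[OF assms]
  by (auto simp: gamma_density_def powr_diff field_simps)

text \<open>
  Chebyshev's inequality: mean and variance of this law both equal \<open>k\<close>. The second moment comes
  from \<open>gamma_density k v * v = k * gamma_density (k + 1) v\<close>.
\<close>

lemma gamma_law_tail:
  assumes k: "k > 0" and d: "d > 0"
  shows "measure (gamma_law k) {v. d \<le> \<bar>v - k\<bar>} \<le> k / d\<^sup>2"
proof -
  interpret prob_space "gamma_law k" by (rule prob_space_gamma_law) fact
  have eq: "gamma_density k v * (v - k)\<^sup>2
      = k * (k + 1) * gamma_density (k + 2) v - 2 * k * k * gamma_density (k + 1) v + k\<^sup>2 * gamma_density k v" for v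
  proof -
    have "gamma_density k v * (v - k)\<^sup>2
      = gamma_density k v * v * v - 2 * k * (gamma_density k v * v) + k\<^sup>2 * gamma_density k v"
      by (simp add: power2_eq_square algebra_simps)
    also have "gamma_density k v * v = k * gamma_density (k + 1) v"
      using k by (rule gamma_density_Suc)
    also have "k * gamma_density (k + 1) v * v = k * ((k + 1) * gamma_density (k + 1 + 1) v)"
      using k gamma_density_Suc[of "k + 1" v] by simp
    finally show ?thesis by (simp add: add.assoc)
  qed
  have "has_bochner_integral lborel (\<lambda>v. gamma_density k v * (v - k)\<^sup>2)
     (k * (k + 1) * 1 - 2 * k * k * 1 + k\<^sup>2 * 1)"
    unfolding eq using k
    by (intro has_bochner_integral_add has_bochner_integral_diff has_bochner_integral_mult_right
        has_bochner_integral_gamma_density) auto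
  then have bi: "has_bochner_integral lborel (\<lambda>v. gamma_density k v * (v - k)\<^sup>2) k"
    by (simp add: power2_eq_square algebra_simps)
  then have int: "(\<integral>\<^sup>+v. ennreal (gamma_density k v * (v - k)\<^sup>2) \<partial>lborel) = ennreal k"
    using k by (subst nn_integral_eq_integral) (auto simp: has_bochner_integral_iff gamma_density_nonneg)
  have "emeasure (gamma_law k) {v. d \<le> \<bar>v - k\<bar>}
      = (\<integral>\<^sup>+v. ennreal (gamma_density k v) * indicator {v. d \<le> \<bar>v - k\<bar>} v \<partial>lborel)"
    unfolding gamma_law_def by (subst emeasure_density) auto
  also have "\<dots> \<le> (\<integral>\<^sup>+v. ennreal (1 / d\<^sup>2) * ennreal (gamma_density k v * (v - k)\<^sup>2) \<partial>lborel)"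
  proof (intro nn_integral_mono)
    fix v
    show "ennreal (gamma_density k v) * indicator {v. d \<le> \<bar>v - k\<bar>} v
      \<le> ennreal (1 / d\<^sup>2) * ennreal (gamma_density k v * (v - k)\<^sup>2)"
    proof (cases "d \<le> \<bar>v - k\<bar>")
      case True
      then have "d\<^sup>2 \<le> (v - k)\<^sup>2" using d by (metis abs_le_square_iff abs_of_pos)
      then have "1 \<le> (v - k)\<^sup>2 / d\<^sup>2" using d by simp
      then have "gamma_density k v * 1 \<le> gamma_density k v * ((v - k)\<^sup>2 / d\<^sup>2)"
        using k by (intro mult_left_mono gamma_density_nonneg) auto
      then show ?thesis using True k by (simp flip: ennreal_mult' add: gamma_density_nonneg)
    qed auto
  qed
  also have "\<dots> = ennreal (1 / d\<^sup>2) * ennreal k"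
    by (subst nn_integral_cmult) (auto simp: int)
  finally have "emeasure (gamma_law k) {v. d \<le> \<bar>v - k\<bar>} \<le> ennreal (k / d\<^sup>2)"
    using k by (simp flip: ennreal_mult')
  then show ?thesis
    using k by (simp add: emeasure_eq_measure)
qed

section \<open>The Gamma mixture identity\<close>

lemma weight_cmult: "weight (\<lambda>i. v * g i) N x = v ^ (\<Sum>i=1..N. x i) * weight g N x"
proof -
  have "weight (\<lambda>i. v * g i) N x = (\<Prod>i=1..N. v ^ x i * (g i ^ x i / fact (x i)))"
    unfolding weight_def by (intro prod.cong) (auto simp: power_mult_distrib)
  also have "\<dots> = (\<Prod>i=1..N. v ^ x i) * weight g N x"
    by (simp only: weight_def prod.distrib)
  finally show ?thesis by (simp only: power_sum)
qed

lemma weight_cong: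
  assumes "\<And>i. i \<in> {1..N} \<Longrightarrow> g i = h i"
  shows "weight g N x = weight h N x"
  unfolding weight_def using assms by (intro prod.cong) auto

lemma EP_SM_prob_eq:
  assumes "x \<in> partition_vectors n n"
  shows "EP_SM_prob \<alpha> \<theta> n x
    = fact n * rising_ratio \<alpha> \<theta> (\<Sum>i=1..n. x i) n * weight (fps_nth (sibuya_fps \<alpha>)) n x"
proof -
  have "weight (fps_nth (sibuya_fps \<alpha>)) n x
      = weight (\<lambda>i. \<alpha> * pochhammer (1 - \<alpha>) (i - 1) / fact i) n x"
    by (intro weight_cong) (simp add: sibuya_fps_nth)
  with assms show ?thesis
    by (simp add: EP_SM_prob_def weight_def partition_vectors_def)
qed

lemma partition_vectors_sum_pos:
  assumes "x \<in> partition_vectors n n" "n \<ge> 1"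
  shows "(\<Sum>i=1..n. x i) \<ge> 1"
proof (rule ccontr)
  assume "\<not> ?thesis"
  then have "(\<Sum>i=1..n. x i) = 0" by linarith
  then have "(\<Sum>i=1..n. i * x i) = 0" by (subst (asm) sum_eq_0_iff) auto
  with assms show False by (auto simp: partition_vectors_def)
qed

text \<open>
  The random variable \<open>S = X powr (- \<alpha>)\<close> has the scaled Mittag-Leffler law if the stable density of
  \<open>X\<close> is reweighted by a multiple of \<open>x powr (- \<theta>)\<close>. This reweighted density is called \<open>tilted\<close>
  below.
\<close>

locale stable_mixture =
  fixes \<alpha> \<theta> :: real and f :: "real \<Rightarrow> real"
  assumes \<alpha>: "0 < \<alpha>" "\<alpha> < 1" and \<theta>: "\<theta> > - \<alpha>" and f: "positive_stable_density \<alpha> f"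
begin

definition "c0 = Gamma (\<theta> + 1) / (\<alpha> * Gamma (\<theta> / \<alpha> + 1))"

definition "tilted x = \<alpha> * c0 * x powr (- \<theta>) * f x"

lemma f_measurable [measurable]: "f \<in> borel_measurable borel"
  and f_nonneg: "f x \<ge> 0"
  and f_nonpos: "x \<le> 0 \<Longrightarrow> f x = 0"
  using f by (auto simp: positive_stable_density_def)

lemma theta_div: "\<theta> / \<alpha> > - 1"
  using \<alpha> \<theta> by (simp add: field_simps)

lemma c0_pos: "c0 > 0"
  unfolding c0_def using \<alpha> \<theta> theta_div by (intro divide_pos_pos mult_pos_pos Gamma_real_pos) auto

lemma tilted_measurable [measurable]: "tilted \<in> borel_measurable borel"
  unfolding tilted_def[abs_def] by measurable

lemma tilted_nonneg: "tilted x \<ge> 0"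
  using c0_pos \<alpha> f_nonneg by (simp add: tilted_def)

text \<open>
  A form without a case distinction at \<open>\<theta> = 0\<close>. The factor \<open>Gamma (\<theta> / \<alpha> + k)\<close> is what the
  normalisation of a Gamma law of shape \<open>\<theta> / \<alpha> + k\<close> cancels.
\<close>

lemma rising_ratio_eq:
  assumes "k \<ge> 1" "n \<ge> 1"
  shows "rising_ratio \<alpha> \<theta> k n = c0 * Gamma (\<theta> / \<alpha> + real k) / Gamma (\<theta> + real n)"
proof (cases "\<theta> = 0")
  case True
  have "c0 = 1 / \<alpha>" unfolding c0_def by (simp add: True)
  with True show ?thesis using assms \<alpha> Gamma_fact[of "k - 1", where ?'a = real] Gamma_fact[of "n - 1", where ?'a = real]
    by (simp add: rising_ratio_def of_nat_diff)
next
  case False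
  have nonint: "x \<notin> \<int>\<^sub>\<le>\<^sub>0" if "x > - 1" "x \<noteq> 0" for x :: real
  proof
    assume "x \<in> \<int>\<^sub>\<le>\<^sub>0"
    then obtain m where m: "x = of_int m" "m \<le> 0" by (auto elim: nonpos_Ints_cases)
    with that have "m > - 1" by linarith
    with m have "m = 0" by linarith
    with m that show False by simp
  qed
  have 1: "\<theta> / \<alpha> \<notin> \<int>\<^sub>\<le>\<^sub>0" using False \<alpha> theta_div by (intro nonint) auto
  have 2: "\<theta> \<notin> \<int>\<^sub>\<le>\<^sub>0" using False \<alpha> \<theta> by (intro nonint) auto
  have "Gamma (\<theta> / \<alpha>) \<noteq> 0" "Gamma \<theta> \<noteq> 0" using 1 2 by (auto simp: Gamma_eq_zero_iff)
  moreover have "Gamma (\<theta> / \<alpha> + 1) = \<theta> / \<alpha> * Gamma (\<theta> / \<alpha>)" "Gamma (\<theta> + 1) = \<theta> * Gamma \<theta>"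
    using Gamma_plus1[OF 1] Gamma_plus1[OF 2] by simp_all
  moreover have "Gamma (\<theta> + real n) > 0" using \<theta> \<alpha> assms by (intro Gamma_real_pos) linarith
  ultimately show ?thesis
    using False \<alpha> 1 2 by (simp add: rising_ratio_def c0_def pochhammer_Gamma field_simps)
qed

lemma shape_pos: "k \<ge> 1 \<Longrightarrow> \<theta> / \<alpha> + real k > 0"
  using theta_div by linarith

lemma shape_pos': "n \<ge> 1 \<Longrightarrow> \<theta> + real n > 0"
  using \<theta> \<alpha> by linarith

lemma EP_SM_prob_nonneg:
  assumes "x \<in> partition_vectors n n" "n \<ge> 1"
  shows "EP_SM_prob \<alpha> \<theta> n x \<ge> 0"
proof -
  have "weight (fps_nth (sibuya_fps \<alpha>)) n x \<ge> 0"
    unfolding weight_def using \<alpha>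
    by (intro prod_nonneg) (auto simp: sibuya_fps_nth intro!: divide_nonneg_pos zero_le_power mult_nonneg_nonneg pochhammer_nonneg)
  moreover have "rising_ratio \<alpha> \<theta> (\<Sum>i=1..n. x i) n \<ge> 0"
    unfolding rising_ratio_eq[OF partition_vectors_sum_pos[OF assms] assms(2)]
    using c0_pos shape_pos[OF partition_vectors_sum_pos[OF assms]] shape_pos'[OF assms(2)]
    by (simp add: Gamma_real_pos less_imp_le)
  ultimately show ?thesis using assms by (simp add: EP_SM_prob_eq)
qed

text \<open>
  The left side is the density of a Gamma variable with the random shape \<open>\<theta> / \<alpha> + K\<close>, where \<open>K\<close> is
  the number of blocks. As \<open>Gamma (\<theta> / \<alpha> + K)\<close> cancels, \<open>K\<close> enters only through \<open>v ^ K\<close>, the sum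
  over the vectors is a coefficient of \<open>exp (v * W)\<close>, and this is a moment of the stable law.
\<close>

lemma gamma_mixture_density:
  assumes n: "n \<ge> 1" and v: "v > 0"
  shows "(\<Sum>x\<in>partition_vectors n n. ennreal (EP_SM_prob \<alpha> \<theta> n x)
            * ennreal (gamma_density (\<theta> / \<alpha> + real (\<Sum>i=1..n. x i)) v))
    = ennreal (c0 / Gamma (\<theta> + real n) * v powr (\<theta> / \<alpha> - 1))
        * (\<integral>\<^sup>+x. ennreal ((v powr (1 / \<alpha>) * x) ^ n * exp (- (v powr (1 / \<alpha>) * x)) * f x) \<partial>lborel)"
proof -
  let ?C = "c0 / Gamma (\<theta> + real n) * v powr (\<theta> / \<alpha> - 1)"
  have G: "Gamma (\<theta> + real n) > 0" using shape_pos'[OF n] by (rule Gamma_real_pos)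
  have summand: "EP_SM_prob \<alpha> \<theta> n x * gamma_density (\<theta> / \<alpha> + real (\<Sum>i=1..n. x i)) v
     = ?C * (fact n * exp (- v) * weight (fps_nth (fps_const v * sibuya_fps \<alpha>)) n x)"
    if x: "x \<in> partition_vectors n n" for x
  proof -
    let ?k = "\<Sum>i=1..n. x i"
    have k: "?k \<ge> 1" using x n by (rule partition_vectors_sum_pos)
    define Gk where "Gk = Gamma (\<theta> / \<alpha> + real ?k)"
    have Gk: "Gk > 0" unfolding Gk_def using shape_pos[OF k] by (rule Gamma_real_pos)
    have pw: "v powr (\<theta> / \<alpha> + real ?k - 1) = v powr (\<theta> / \<alpha> - 1) * v ^ ?k"
    proof -
      have "\<theta> / \<alpha> + real ?k - 1 = (\<theta> / \<alpha> - 1) + real ?k" by simp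
      then show ?thesis using v by (simp only: powr_add powr_realpow)
    qed
    have wt: "weight (fps_nth (fps_const v * sibuya_fps \<alpha>)) n x
        = v ^ ?k * weight (fps_nth (sibuya_fps \<alpha>)) n x"
      by (subst weight_cmult[symmetric], intro weight_cong) simp
    have gd: "gamma_density (\<theta> / \<alpha> + real ?k) v = v powr (\<theta> / \<alpha> - 1) * v ^ ?k * exp (- v) / Gk"
      using v by (simp only: gamma_density_def pw Gk_def if_True)
    show ?thesis
      unfolding EP_SM_prob_eq[OF x] rising_ratio_eq[OF k n] gd wt unfolding Gk_def[symmetric]
      using Gk by (simp add: mult_ac)
  qed
  have "(\<Sum>x\<in>partition_vectors n n. ennreal (EP_SM_prob \<alpha> \<theta> n x)
            * ennreal (gamma_density (\<theta> / \<alpha> + real (\<Sum>i=1..n. x i)) v))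
     = (\<Sum>x\<in>partition_vectors n n. ennreal (EP_SM_prob \<alpha> \<theta> n x
            * gamma_density (\<theta> / \<alpha> + real (\<Sum>i=1..n. x i)) v))"
    using EP_SM_prob_nonneg n by (intro sum.cong) (auto simp: ennreal_mult')
  also have "\<dots> = ennreal (\<Sum>x\<in>partition_vectors n n. EP_SM_prob \<alpha> \<theta> n x
            * gamma_density (\<theta> / \<alpha> + real (\<Sum>i=1..n. x i)) v)"
    using n by (intro sum_ennreal mult_nonneg_nonneg gamma_density_nonneg EP_SM_prob_nonneg
        shape_pos partition_vectors_sum_pos)
  also have "(\<Sum>x\<in>partition_vectors n n. EP_SM_prob \<alpha> \<theta> n x
            * gamma_density (\<theta> / \<alpha> + real (\<Sum>i=1..n. x i)) v)
     = ?C * (fact n * exp (- v) * partition_sum (fps_nth (fps_const v * sibuya_fps \<alpha>)) n n)"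
    unfolding partition_sum_def sum_distrib_left by (intro sum.cong summand) auto
  also have "partition_sum (fps_nth (fps_const v * sibuya_fps \<alpha>)) n n
     = fps_nth (fps_exp 1 oo (fps_const v * sibuya_fps \<alpha>)) n"
    by (intro partition_sum_eq_fps_exp) auto
  also have "ennreal (?C * (fact n * exp (- v) * fps_nth (fps_exp 1 oo (fps_const v * sibuya_fps \<alpha>)) n))
     = ennreal ?C * ennreal (fact n * exp (- v) * fps_nth (fps_exp 1 oo (fps_const v * sibuya_fps \<alpha>)) n)"
    using c0_pos G by (intro ennreal_mult') simp
  also have "ennreal (fact n * exp (- v) * fps_nth (fps_exp 1 oo (fps_const v * sibuya_fps \<alpha>)) n)
     = (\<integral>\<^sup>+x. ennreal ((v powr (1 / \<alpha>) * x) ^ n * exp (- (v powr (1 / \<alpha>) * x)) * f x) \<partial>lborel)"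
    using stable_density_moment[OF f, of "v powr (1 / \<alpha>)" n] \<alpha> v by (simp add: powr_powr)
  finally show ?thesis .
qed

text \<open>
  In distribution, a Gamma variable of the random shape \<open>\<theta> / \<alpha> + K\<close> equals \<open>Y powr \<alpha> * S\<close> with
  independent \<open>Y\<close>, of Gamma law with shape \<open>\<theta> + n\<close>, and \<open>S = X powr (- \<alpha>)\<close>, where \<open>X\<close> has the
  tilted density. Exchange the integrals over \<open>v\<close> and \<open>x\<close> and substitute \<open>v = (w / x) powr \<alpha>\<close>;
  then \<open>(c * x) ^ n * exp (- (c * x))\<close> with \<open>c = v powr (1 / \<alpha>)\<close> turns into \<open>w ^ n * exp (- w)\<close>.
\<close>

lemma gamma_mixture_identity:
  fixes \<psi> :: "real \<Rightarrow> ennreal"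
  assumes n: "n \<ge> 1" and [measurable]: "\<psi> \<in> borel_measurable borel"
  shows "(\<Sum>x\<in>partition_vectors n n. ennreal (EP_SM_prob \<alpha> \<theta> n x)
            * (\<integral>\<^sup>+v. \<psi> v \<partial>gamma_law (\<theta> / \<alpha> + real (\<Sum>i=1..n. x i))))
    = (\<integral>\<^sup>+x. ennreal (tilted x) * (\<integral>\<^sup>+w. \<psi> ((w / x) powr \<alpha>) \<partial>gamma_law (\<theta> + real n)) \<partial>lborel)"
proof -
  have G: "Gamma (\<theta> + real n) > 0" using shape_pos'[OF n] by (rule Gamma_real_pos)
  define C where "C = c0 / Gamma (\<theta> + real n)"
  have C: "C > 0" using c0_pos G by (simp add: C_def)
  define J where "J v x = \<psi> v * ennreal (C * v powr (\<theta> / \<alpha> - 1) *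
      ((v powr (1 / \<alpha>) * x) ^ n * exp (- (v powr (1 / \<alpha>) * x)) * f x)) * indicator {0<..} v" for v x
  have [measurable]: "case_prod J \<in> borel_measurable (borel \<Otimes>\<^sub>M borel)"
    unfolding J_def by measurable
  have "(\<Sum>x\<in>partition_vectors n n. ennreal (EP_SM_prob \<alpha> \<theta> n x)
            * (\<integral>\<^sup>+v. \<psi> v \<partial>gamma_law (\<theta> / \<alpha> + real (\<Sum>i=1..n. x i))))
     = (\<Sum>x\<in>partition_vectors n n. (\<integral>\<^sup>+v. ennreal (EP_SM_prob \<alpha> \<theta> n x)
            * (ennreal (gamma_density (\<theta> / \<alpha> + real (\<Sum>i=1..n. x i)) v) * \<psi> v) \<partial>lborel))"
    unfolding gamma_law_def by (intro sum.cong refl) (simp add: nn_integral_density nn_integral_cmult)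
  also have "\<dots> = (\<integral>\<^sup>+v. (\<Sum>x\<in>partition_vectors n n. ennreal (EP_SM_prob \<alpha> \<theta> n x)
            * (ennreal (gamma_density (\<theta> / \<alpha> + real (\<Sum>i=1..n. x i)) v) * \<psi> v)) \<partial>lborel)"
    by (intro nn_integral_sum[symmetric]) measurable
  also have "\<dots> = (\<integral>\<^sup>+v. (\<integral>\<^sup>+x. J v x \<partial>lborel) \<partial>lborel)"
  proof (intro nn_integral_cong)
    fix v :: real
    show "(\<Sum>x\<in>partition_vectors n n. ennreal (EP_SM_prob \<alpha> \<theta> n x)
            * (ennreal (gamma_density (\<theta> / \<alpha> + real (\<Sum>i=1..n. x i)) v) * \<psi> v)) = (\<integral>\<^sup>+x. J v x \<partial>lborel)"
    proof (cases "v > 0")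
      case False
      then show ?thesis by (simp add: gamma_density_def J_def)
    next
      case True
      have "(\<Sum>x\<in>partition_vectors n n. ennreal (EP_SM_prob \<alpha> \<theta> n x)
            * (ennreal (gamma_density (\<theta> / \<alpha> + real (\<Sum>i=1..n. x i)) v) * \<psi> v))
         = \<psi> v * (\<Sum>x\<in>partition_vectors n n. ennreal (EP_SM_prob \<alpha> \<theta> n x)
            * ennreal (gamma_density (\<theta> / \<alpha> + real (\<Sum>i=1..n. x i)) v))"
        by (simp only: sum_distrib_left mult_ac)
      also have "\<dots> = \<psi> v * ennreal (C * v powr (\<theta> / \<alpha> - 1))
        * (\<integral>\<^sup>+x. ennreal ((v powr (1 / \<alpha>) * x) ^ n * exp (- (v powr (1 / \<alpha>) * x)) * f x) \<partial>lborel)"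
        unfolding gamma_mixture_density[OF n True] C_def by (simp add: mult.assoc)
      also have "\<dots> = (\<integral>\<^sup>+x. \<psi> v * ennreal (C * v powr (\<theta> / \<alpha> - 1)) *
          ennreal ((v powr (1 / \<alpha>) * x) ^ n * exp (- (v powr (1 / \<alpha>) * x)) * f x) \<partial>lborel)"
        by (intro nn_integral_cmult[symmetric]) measurable
      also have "\<dots> = (\<integral>\<^sup>+x. J v x \<partial>lborel)"
      proof (intro nn_integral_cong)
        fix x
        have "ennreal (C * v powr (\<theta> / \<alpha> - 1)) *
          ennreal ((v powr (1 / \<alpha>) * x) ^ n * exp (- (v powr (1 / \<alpha>) * x)) * f x)
          = ennreal (C * v powr (\<theta> / \<alpha> - 1) *
          ((v powr (1 / \<alpha>) * x) ^ n * exp (- (v powr (1 / \<alpha>) * x)) * f x))"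
          using C by (intro ennreal_mult'[symmetric]) simp
        then show "\<psi> v * ennreal (C * v powr (\<theta> / \<alpha> - 1)) *
          ennreal ((v powr (1 / \<alpha>) * x) ^ n * exp (- (v powr (1 / \<alpha>) * x)) * f x) = J v x"
          using True by (simp only: J_def mult.assoc) simp
      qed
      finally show ?thesis .
    qed
  qed
  also have "\<dots> = (\<integral>\<^sup>+x. (\<integral>\<^sup>+v. J v x \<partial>lborel) \<partial>lborel)"
    by (intro lborel_pair.Fubini'[symmetric]) measurable
  also have "\<dots> = (\<integral>\<^sup>+x. ennreal (tilted x) * (\<integral>\<^sup>+w. \<psi> ((w / x) powr \<alpha>) \<partial>gamma_law (\<theta> + real n)) \<partial>lborel)"
  proof (intro nn_integral_cong)
    fix x :: real
    show "(\<integral>\<^sup>+v. J v x \<partial>lborel)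
      = ennreal (tilted x) * (\<integral>\<^sup>+w. \<psi> ((w / x) powr \<alpha>) \<partial>gamma_law (\<theta> + real n))"
    proof (cases "x > 0")
      case False
      then show ?thesis by (simp add: J_def tilted_def f_nonpos)
    next
      case x: True
      have "(\<integral>\<^sup>+v. J v x \<partial>lborel)
        = (\<integral>\<^sup>+w. \<psi> (x powr (- \<alpha>) * w powr \<alpha>) * ennreal (C * (x powr (- \<alpha>) * w powr \<alpha>) powr (\<theta> / \<alpha> - 1) *
            (((x powr (- \<alpha>) * w powr \<alpha>) powr (1 / \<alpha>) * x) ^ n
              * exp (- ((x powr (- \<alpha>) * w powr \<alpha>) powr (1 / \<alpha>) * x)) * f x))
            * ennreal (\<bar>\<alpha>\<bar> * x powr (- \<alpha>) * w powr (\<alpha> - 1)) * indicator {0<..} w \<partial>lborel)"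
        unfolding J_def using x \<alpha> by (intro nn_integral_powr_substitution) auto
      also have "\<dots> = (\<integral>\<^sup>+w. ennreal (tilted x) * (ennreal (gamma_density (\<theta> + real n) w) * \<psi> ((w / x) powr \<alpha>)) \<partial>lborel)"
      proof (intro nn_integral_cong)
        fix w :: real
        show "\<psi> (x powr (- \<alpha>) * w powr \<alpha>) * ennreal (C * (x powr (- \<alpha>) * w powr \<alpha>) powr (\<theta> / \<alpha> - 1) *
            (((x powr (- \<alpha>) * w powr \<alpha>) powr (1 / \<alpha>) * x) ^ n
              * exp (- ((x powr (- \<alpha>) * w powr \<alpha>) powr (1 / \<alpha>) * x)) * f x))
            * ennreal (\<bar>\<alpha>\<bar> * x powr (- \<alpha>) * w powr (\<alpha> - 1)) * indicator {0<..} w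
          = ennreal (tilted x) * (ennreal (gamma_density (\<theta> + real n) w) * \<psi> ((w / x) powr \<alpha>))"
        proof (cases "w > 0")
          case w: True
          have v: "x powr (- \<alpha>) * w powr \<alpha> = (w / x) powr \<alpha>"
            using x w by (simp add: powr_divide powr_minus field_simps)
          have root: "((w / x) powr \<alpha>) powr (1 / \<alpha>) * x = w"
            using x w \<alpha> by (simp add: powr_powr)
          have pw: "((w / x) powr \<alpha>) powr (\<theta> / \<alpha> - 1) = w powr (\<theta> - \<alpha>) * x powr (\<alpha> - \<theta>)"
          proof -
            have "\<alpha> * (\<theta> / \<alpha> - 1) = \<theta> - \<alpha>" using \<alpha> by (simp add: field_simps)
            then have "((w / x) powr \<alpha>) powr (\<theta> / \<alpha> - 1) = w powr (\<theta> - \<alpha>) / x powr (\<theta> - \<alpha>)"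
              using x w by (simp add: powr_powr powr_divide)
            also have "x powr (\<theta> - \<alpha>) = inverse (x powr (\<alpha> - \<theta>))"
              by (subst powr_minus[symmetric]) simp
            finally show ?thesis by (simp add: divide_inverse)
          qed
          have "C * (w powr (\<theta> - \<alpha>) * x powr (\<alpha> - \<theta>)) * (w ^ n * exp (- w) * f x)
              * (\<bar>\<alpha>\<bar> * x powr (- \<alpha>) * w powr (\<alpha> - 1))
            = \<alpha> * C * (x powr (\<alpha> - \<theta>) * x powr (- \<alpha>)) * f x
              * (w powr (\<theta> - \<alpha>) * w powr (\<alpha> - 1) * w powr (real n)) * exp (- w)"
            using \<alpha> w by (simp add: powr_realpow mult_ac)
          also have "x powr (\<alpha> - \<theta>) * x powr (- \<alpha>) = x powr (- \<theta>)"
            by (simp flip: powr_add)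
          also have "w powr (\<theta> - \<alpha>) * w powr (\<alpha> - 1) * w powr (real n) = w powr (\<theta> + real n - 1)"
            by (simp flip: powr_add add: algebra_simps)
          also have "\<alpha> * C * x powr (- \<theta>) * f x * w powr (\<theta> + real n - 1) * exp (- w)
            = tilted x * gamma_density (\<theta> + real n) w"
            using w by (simp add: tilted_def gamma_density_def C_def)
          finally have eq: "C * (w powr (\<theta> - \<alpha>) * x powr (\<alpha> - \<theta>)) * (w ^ n * exp (- w) * f x)
              * (\<bar>\<alpha>\<bar> * x powr (- \<alpha>) * w powr (\<alpha> - 1))
            = tilted x * gamma_density (\<theta> + real n) w" .
          have "ennreal (C * (w powr (\<theta> - \<alpha>) * x powr (\<alpha> - \<theta>)) * (w ^ n * exp (- w) * f x))
              * ennreal (\<bar>\<alpha>\<bar> * x powr (- \<alpha>) * w powr (\<alpha> - 1))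
            = ennreal (tilted x) * ennreal (gamma_density (\<theta> + real n) w)"
            using tilted_nonneg[of x] eq \<alpha> by (simp flip: ennreal_mult' ennreal_mult'' )
          then show ?thesis
            unfolding v root pw using w by (simp add: mult_ac)
        qed (simp add: gamma_density_def)
      qed
      also have "\<dots> = ennreal (tilted x) * (\<integral>\<^sup>+w. \<psi> ((w / x) powr \<alpha>) \<partial>gamma_law (\<theta> + real n))"
        unfolding gamma_law_def by (simp add: nn_integral_density nn_integral_cmult)
      finally show ?thesis .
    qed
  qed
  finally show ?thesis .
qed

end

section \<open>Concentration of Gamma laws and the Mittag-Leffler limit\<close>

lemma powr_le_powr_iff:
  fixes a x y :: real
  assumes "a > 0" "x \<ge> 0" "y \<ge> 0"
  shows "x powr a \<le> y powr a \<longleftrightarrow> x \<le> y"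
  using assms powr_mono2[of a x y] powr_less_mono2[of a y x] by (auto simp: not_less[symmetric])

lemma AE_gamma_law_pos: "AE w in gamma_law k. w > 0"
  unfolding gamma_law_def by (subst AE_density) (auto simp: gamma_density_def intro!: AE_I2 split: if_splits)

lemma cdf_gamma_law_le_1: "k > 0 \<Longrightarrow> cdf (gamma_law k) y \<le> 1"
  unfolding cdf_def by (rule prob_space.prob_le_1[OF prob_space_gamma_law])

lemma cdf_gamma_law_le:
  assumes "k > 0" "y < k"
  shows "cdf (gamma_law k) y \<le> k / (k - y)\<^sup>2"
proof -
  interpret prob_space "gamma_law k" by (rule prob_space_gamma_law) fact
  have "cdf (gamma_law k) y \<le> measure (gamma_law k) {v. k - y \<le> \<bar>v - k\<bar>}"
    unfolding cdf_def by (intro finite_measure_mono) auto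
  also have "\<dots> \<le> k / (k - y)\<^sup>2" using assms by (intro gamma_law_tail) auto
  finally show ?thesis .
qed

lemma cdf_gamma_law_ge:
  assumes "k > 0" "k < y"
  shows "1 - k / (y - k)\<^sup>2 \<le> cdf (gamma_law k) y"
proof -
  interpret prob_space "gamma_law k" by (rule prob_space_gamma_law) fact
  have "1 - cdf (gamma_law k) y = measure (gamma_law k) (space (gamma_law k) - {..y})"
    unfolding cdf_def by (subst prob_compl) auto
  also have "\<dots> \<le> measure (gamma_law k) {v. y - k \<le> \<bar>v - k\<bar>}"
    by (intro finite_measure_mono) auto
  also have "\<dots> \<le> k / (y - k)\<^sup>2" using assms by (intro gamma_law_tail) auto
  finally show ?thesis by simp
qed

text \<open>
  A law of large numbers: the Gamma variable is of the order of its shape \<open>\<theta> + n\<close>, hence of \<open>n\<close>.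
\<close>

lemma gamma_law_lln:
  assumes "\<theta> > - 1" "r \<noteq> 1"
  shows "(\<lambda>i. cdf (gamma_law (\<theta> + real (Suc i))) (real (Suc i) * r)) \<longlonglongrightarrow> (if 1 < r then 1 else 0)"
proof -
  have k: "\<theta> + real (Suc i) > 0" for i using assms by simp
  consider "r < 1" | "r > 1" using assms by linarith
  then show ?thesis
  proof cases
    case 1
    define s where "s = 1 - r"
    have s: "s > 0" "r = 1 - s" using 1 by (auto simp: s_def)
    have "(\<lambda>i. cdf (gamma_law (\<theta> + real (Suc i))) (real (Suc i) * r)) \<longlonglongrightarrow> 0"
    proof (rule tendsto_sandwich[OF _ _ tendsto_const])
      show "\<forall>\<^sub>F i in sequentially. 0 \<le> cdf (gamma_law (\<theta> + real (Suc i))) (real (Suc i) * r)"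
        by (simp add: cdf_def)
      have "\<forall>\<^sub>F i in sequentially. real (Suc i) * r < \<theta> + real (Suc i)"
        using s by real_asymp
      then show "\<forall>\<^sub>F i in sequentially. cdf (gamma_law (\<theta> + real (Suc i))) (real (Suc i) * r)
        \<le> (\<theta> + real (Suc i)) / (\<theta> + real (Suc i) - real (Suc i) * r)\<^sup>2"
        by eventually_elim (rule cdf_gamma_law_le[OF k])
      show "(\<lambda>i. (\<theta> + real (Suc i)) / (\<theta> + real (Suc i) - real (Suc i) * r)\<^sup>2) \<longlonglongrightarrow> 0"
        unfolding s(2) using s(1) by real_asymp
    qed
    then show ?thesis using 1 by simp
  next
    case 2
    define s where "s = r - 1"
    have s: "s > 0" "r = 1 + s" using 2 by (auto simp: s_def)
    have "(\<lambda>i. cdf (gamma_law (\<theta> + real (Suc i))) (real (Suc i) * r)) \<longlonglongrightarrow> 1"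
    proof (rule tendsto_sandwich[OF _ _ _ tendsto_const])
      show "\<forall>\<^sub>F i in sequentially. cdf (gamma_law (\<theta> + real (Suc i))) (real (Suc i) * r) \<le> 1"
        using k by (intro always_eventually allI cdf_gamma_law_le_1)
      have "\<forall>\<^sub>F i in sequentially. \<theta> + real (Suc i) < real (Suc i) * r"
        using s by real_asymp
      then show "\<forall>\<^sub>F i in sequentially. 1 - (\<theta> + real (Suc i)) / (real (Suc i) * r - (\<theta> + real (Suc i)))\<^sup>2
        \<le> cdf (gamma_law (\<theta> + real (Suc i))) (real (Suc i) * r)"
        by eventually_elim (rule cdf_gamma_law_ge[OF k])
      show "(\<lambda>i. 1 - (\<theta> + real (Suc i)) / (real (Suc i) * r - (\<theta> + real (Suc i)))\<^sup>2) \<longlonglongrightarrow> 1"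
        unfolding s(2) using s(1) by real_asymp
    qed
    then show ?thesis using 2 by simp
  qed
qed

text \<open>
  If \<open>F n\<close> lies asymptotically between values that converge to \<open>G\<close> slightly to the left and slightly
  to the right of \<open>y\<close>, continuity of \<open>G\<close> closes the gap.
\<close>

lemma tendsto_sandwich_isCont:
  fixes G :: "real \<Rightarrow> real"
  assumes G: "isCont G y" and y: "y > 0"
    and up: "\<And>\<epsilon>. \<epsilon> > 0 \<Longrightarrow> \<exists>u. u \<longlonglongrightarrow> G (y + \<epsilon>) \<and> (\<forall>\<^sub>F n in sequentially. F n \<le> u n)"
    and lo: "\<And>\<epsilon>. 0 < \<epsilon> \<Longrightarrow> \<epsilon> < y \<Longrightarrow> \<exists>l. l \<longlonglongrightarrow> G (y - \<epsilon>) \<and> (\<forall>\<^sub>F n in sequentially. l n \<le> F n)"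
  shows "F \<longlonglongrightarrow> G y"
proof (rule order_tendstoI)
  fix a assume a: "a < G y"
  have "((\<lambda>\<epsilon>. G (y - \<epsilon>)) \<longlongrightarrow> G (y - 0)) (at_right 0)"
    using G by (intro isCont_tendsto_compose[of _ G] tendsto_intros) simp
  then have "\<forall>\<^sub>F \<epsilon> in at_right 0. a < G (y - \<epsilon>)"
    using a by (auto dest: order_tendstoD)
  moreover have "\<forall>\<^sub>F \<epsilon> in at_right (0::real). 0 < \<epsilon> \<and> \<epsilon> < y"
    using y by (auto simp: eventually_at_right_field)
  ultimately have "\<forall>\<^sub>F \<epsilon> in at_right 0. a < G (y - \<epsilon>) \<and> 0 < \<epsilon> \<and> \<epsilon> < y"
    by eventually_elim simp
  then obtain \<epsilon> where "a < G (y - \<epsilon>)" "0 < \<epsilon>" "\<epsilon> < y"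
    by (metis (mono_tags, lifting) eventually_happens trivial_limit_at_right_real)
  then obtain l where l: "l \<longlonglongrightarrow> G (y - \<epsilon>)" "\<forall>\<^sub>F n in sequentially. l n \<le> F n"
    using lo by blast
  from order_tendstoD(1)[OF l(1) \<open>a < G (y - \<epsilon>)\<close>] l(2)
  show "\<forall>\<^sub>F n in sequentially. a < F n" by eventually_elim simp
next
  fix a assume a: "G y < a"
  have "((\<lambda>\<epsilon>. G (y + \<epsilon>)) \<longlongrightarrow> G (y + 0)) (at_right 0)"
    using G by (intro isCont_tendsto_compose[of _ G] tendsto_intros) simp
  then have "\<forall>\<^sub>F \<epsilon> in at_right 0. G (y + \<epsilon>) < a"
    using a by (auto dest: order_tendstoD)
  moreover have "\<forall>\<^sub>F \<epsilon> in at_right (0::real). 0 < \<epsilon>"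
    by (rule eventually_at_right_less)
  ultimately have "\<forall>\<^sub>F \<epsilon> in at_right 0. G (y + \<epsilon>) < a \<and> 0 < \<epsilon>"
    by eventually_elim simp
  then obtain \<epsilon> where "G (y + \<epsilon>) < a" "0 < \<epsilon>"
    by (metis (mono_tags, lifting) eventually_happens trivial_limit_at_right_real)
  then obtain u where u: "u \<longlonglongrightarrow> G (y + \<epsilon>)" "\<forall>\<^sub>F n in sequentially. F n \<le> u n"
    using up by blast
  from order_tendstoD(2)[OF u(1) \<open>G (y + \<epsilon>) < a\<close>] u(2)
  show "\<forall>\<^sub>F n in sequentially. F n < a" by eventually_elim simp
qed

context stable_mixture
begin

definition "gamma_mixture n y = (\<Sum>x\<in>partition_vectors n n. EP_SM_prob \<alpha> \<theta> n x *
    cdf (gamma_law (\<theta> / \<alpha> + real (\<Sum>i=1..n. x i))) (real n powr \<alpha> * y))"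

text \<open>
  The mixture identity for the indicator of a half-line.
\<close>

lemma ennreal_gamma_mixture:
  assumes n: "n \<ge> 1" and y: "y > 0"
  shows "ennreal (gamma_mixture n y)
    = (\<integral>\<^sup>+x. ennreal (tilted x) * ennreal (cdf (gamma_law (\<theta> + real n)) (real n * (y powr (1 / \<alpha>) * x))) \<partial>lborel)"
proof -
  let ?\<psi> = "indicator {..real n powr \<alpha> * y} :: real \<Rightarrow> ennreal"
  have em: "emeasure (gamma_law k) A = ennreal (measure (gamma_law k) A)" if "k > 0" for k A
  proof -
    interpret prob_space "gamma_law k" by (rule prob_space_gamma_law) fact
    show ?thesis by (rule emeasure_eq_measure)
  qed
  have k: "\<theta> / \<alpha> + real (\<Sum>i=1..n. x i) > 0" if "x \<in> partition_vectors n n" for x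
    using that n by (intro shape_pos partition_vectors_sum_pos)
  have "ennreal (gamma_mixture n y) = (\<Sum>x\<in>partition_vectors n n. ennreal (EP_SM_prob \<alpha> \<theta> n x *
    cdf (gamma_law (\<theta> / \<alpha> + real (\<Sum>i=1..n. x i))) (real n powr \<alpha> * y)))"
    unfolding gamma_mixture_def using n
    by (intro sum_ennreal[symmetric] mult_nonneg_nonneg EP_SM_prob_nonneg) (auto simp: cdf_def)
  also have "\<dots> = (\<Sum>x\<in>partition_vectors n n. ennreal (EP_SM_prob \<alpha> \<theta> n x)
            * (\<integral>\<^sup>+v. ?\<psi> v \<partial>gamma_law (\<theta> / \<alpha> + real (\<Sum>i=1..n. x i))))"
    using n k by (intro sum.cong refl) (simp add: ennreal_mult' EP_SM_prob_nonneg em cdf_def del: of_nat_sum)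
  also have "\<dots> = (\<integral>\<^sup>+x. ennreal (tilted x) * (\<integral>\<^sup>+w. ?\<psi> ((w / x) powr \<alpha>) \<partial>gamma_law (\<theta> + real n)) \<partial>lborel)"
    using n by (intro gamma_mixture_identity) auto
  also have "\<dots> = (\<integral>\<^sup>+x. ennreal (tilted x) * ennreal (cdf (gamma_law (\<theta> + real n)) (real n * (y powr (1 / \<alpha>) * x))) \<partial>lborel)"
  proof (intro nn_integral_cong)
    fix x :: real
    show "ennreal (tilted x) * (\<integral>\<^sup>+w. ?\<psi> ((w / x) powr \<alpha>) \<partial>gamma_law (\<theta> + real n))
      = ennreal (tilted x) * ennreal (cdf (gamma_law (\<theta> + real n)) (real n * (y powr (1 / \<alpha>) * x)))"
    proof (cases "x > 0")
      case False
      then show ?thesis by (simp add: tilted_def f_nonpos)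
    next
      case x: True
      have "(\<integral>\<^sup>+w. ?\<psi> ((w / x) powr \<alpha>) \<partial>gamma_law (\<theta> + real n))
        = (\<integral>\<^sup>+w. indicator {..real n * (y powr (1 / \<alpha>) * x)} w \<partial>gamma_law (\<theta> + real n))"
      proof (intro nn_integral_cong_AE)
        show "AE w in gamma_law (\<theta> + real n). ?\<psi> ((w / x) powr \<alpha>)
          = indicator {..real n * (y powr (1 / \<alpha>) * x)} w"
          using AE_gamma_law_pos
        proof eventually_elim
          case (elim w)
          have root: "(real n powr \<alpha> * y) powr (1 / \<alpha>) = real n * y powr (1 / \<alpha>)"
            using y n \<alpha> by (simp add: powr_mult powr_powr)
          have "(w / x) powr \<alpha> \<le> real n powr \<alpha> * y
            \<longleftrightarrow> ((w / x) powr \<alpha>) powr (1 / \<alpha>) \<le> (real n powr \<alpha> * y) powr (1 / \<alpha>)"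
            using \<alpha> y by (intro powr_le_powr_iff[symmetric]) (use elim x in auto)
          also have "\<dots> \<longleftrightarrow> w / x \<le> real n * y powr (1 / \<alpha>)"
            unfolding root using elim x \<alpha> by (simp add: powr_powr)
          also have "\<dots> \<longleftrightarrow> w \<le> real n * (y powr (1 / \<alpha>) * x)"
            using x by (simp add: divide_le_eq mult.assoc)
          finally show ?case by (simp add: indicator_def)
        qed
      qed
      also have "\<dots> = ennreal (cdf (gamma_law (\<theta> + real n)) (real n * (y powr (1 / \<alpha>) * x)))"
        using shape_pos'[OF n] by (simp add: em cdf_def)
      finally show ?thesis by simp
    qed
  qed
  finally show ?thesis .
qed

text \<open>
  Substitute \<open>x = s powr (- 1 / \<alpha>)\<close>, which reverses the order.
\<close>

lemma emeasure_scaled_ML: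
  assumes y: "y > 0"
  shows "emeasure (density lborel (scaled_ML_density \<alpha> \<theta> f)) {..y}
    = (\<integral>\<^sup>+x. ennreal (tilted x) * indicator {y powr (- (1 / \<alpha>))..} x \<partial>lborel)"
proof -
  have [measurable]: "scaled_ML_density \<alpha> \<theta> f \<in> borel_measurable borel"
    unfolding scaled_ML_density_def[abs_def] by measurable
  have "(\<integral>\<^sup>+x. ennreal (tilted x) * indicator {y powr (- (1 / \<alpha>))..} x \<partial>lborel)
    = (\<integral>\<^sup>+x. ennreal (tilted x) * indicator {y powr (- (1 / \<alpha>))..} x * indicator {0<..} x \<partial>lborel)"
    by (intro nn_integral_cong) (auto simp: tilted_def f_nonpos split: split_indicator)
  also have "\<dots> = (\<integral>\<^sup>+s. ennreal (tilted (1 * s powr (- (1 / \<alpha>)))) * indicator {y powr (- (1 / \<alpha>))..} (1 * s powr (- (1 / \<alpha>)))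
      * ennreal (\<bar>- (1 / \<alpha>)\<bar> * 1 * s powr (- (1 / \<alpha>) - 1)) * indicator {0<..} s \<partial>lborel)"
    using \<alpha> by (intro nn_integral_powr_substitution) auto
  also have "\<dots> = (\<integral>\<^sup>+s. ennreal (scaled_ML_density \<alpha> \<theta> f s) * indicator {..y} s \<partial>lborel)"
  proof (intro nn_integral_cong)
    fix s :: real
    show "ennreal (tilted (1 * s powr (- (1 / \<alpha>)))) * indicator {y powr (- (1 / \<alpha>))..} (1 * s powr (- (1 / \<alpha>)))
      * ennreal (\<bar>- (1 / \<alpha>)\<bar> * 1 * s powr (- (1 / \<alpha>) - 1)) * indicator {0<..} s
      = ennreal (scaled_ML_density \<alpha> \<theta> f s) * indicator {..y} s"
    proof (cases "s > 0")
      case False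
      then show ?thesis by (simp add: scaled_ML_density_def)
    next
      case s: True
      have ord: "y powr (- (1 / \<alpha>)) \<le> s powr (- (1 / \<alpha>)) \<longleftrightarrow> s \<le> y"
        using s y \<alpha> powr_le_powr_iff[of "1/\<alpha>" s y] by (simp add: powr_minus field_simps)
      have "tilted (s powr (- (1 / \<alpha>))) * (1 / \<alpha> * s powr (- (1 / \<alpha>) - 1))
        = c0 * ((s powr (- (1 / \<alpha>))) powr (- \<theta>) * s powr (- (1 / \<alpha>) - 1)) * f (s powr (- (1 / \<alpha>)))"
        using \<alpha> by (simp add: tilted_def)
      also have "(s powr (- (1 / \<alpha>))) powr (- \<theta>) * s powr (- (1 / \<alpha>) - 1) = s powr ((\<theta> - 1) / \<alpha> - 1)"
      proof -
        have "- (1 / \<alpha>) * - \<theta> + (- (1 / \<alpha>) - 1) = (\<theta> - 1) / \<alpha> - 1"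
          by (simp add: diff_divide_distrib)
        then show ?thesis by (simp only: powr_powr powr_add[symmetric])
      qed
      also have "c0 * s powr ((\<theta> - 1) / \<alpha> - 1) * f (s powr (- (1 / \<alpha>))) = scaled_ML_density \<alpha> \<theta> f s"
        using s by (simp add: scaled_ML_density_def c0_def)
      finally have "ennreal (tilted (s powr (- (1 / \<alpha>)))) * ennreal (1 / \<alpha> * s powr (- (1 / \<alpha>) - 1))
        = ennreal (scaled_ML_density \<alpha> \<theta> f s)"
        using tilted_nonneg by (simp flip: ennreal_mult')
      then show ?thesis using s ord \<alpha> by (auto simp: indicator_def abs_if)
    qed
  qed
  also have "\<dots> = emeasure (density lborel (scaled_ML_density \<alpha> \<theta> f)) {..y}"
    by (subst emeasure_density) auto
  finally show ?thesis by simp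
qed

text \<open>
  The mixture identity for the constant 1: on its left side stands the total probability of the
  sampling model for \<open>n = 1\<close>. This evaluates \<open>E (X powr (- \<theta>))\<close>.
\<close>

lemma tilted_mass:
  assumes "(\<Sum>x\<in>partition_vectors 1 1. EP_SM_prob \<alpha> \<theta> 1 x) = 1"
  shows "(\<integral>\<^sup>+x. ennreal (tilted x) \<partial>lborel) = 1"
proof -
  have one: "(\<integral>\<^sup>+v. 1 \<partial>gamma_law k) = 1" if "k > 0" for k
    using prob_space.emeasure_space_1[OF prob_space_gamma_law[OF that]] by simp
  have k: "\<theta> / \<alpha> + real (\<Sum>i=1..1. x i) > 0" if "x \<in> partition_vectors 1 1" for x
    using that by (intro shape_pos partition_vectors_sum_pos) auto
  have "(\<integral>\<^sup>+x. ennreal (tilted x) \<partial>lborel)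
    = (\<integral>\<^sup>+x. ennreal (tilted x) * (\<integral>\<^sup>+w. 1 \<partial>gamma_law (\<theta> + real 1)) \<partial>lborel)"
    using shape_pos'[of 1] by (subst one) auto
  also have "\<dots> = (\<Sum>x\<in>partition_vectors 1 1. ennreal (EP_SM_prob \<alpha> \<theta> 1 x)
            * (\<integral>\<^sup>+v. 1 \<partial>gamma_law (\<theta> / \<alpha> + real (\<Sum>i=1..1. x i))))"
    by (intro gamma_mixture_identity[symmetric]) auto
  also have "\<dots> = (\<Sum>x\<in>partition_vectors 1 1. ennreal (EP_SM_prob \<alpha> \<theta> 1 x))"
    using k by (intro sum.cong refl) (subst one, auto)
  also have "\<dots> = ennreal 1"
    using assms by (subst sum_ennreal) (auto intro: EP_SM_prob_nonneg)
  finally show ?thesis by simp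
qed

text \<open>
  By the law of large numbers the Gamma distribution functions under the integral tend to a step
  function of \<open>x\<close>, and the tilted density dominates.
\<close>

lemma gamma_mixture_limit:
  assumes mass: "(\<Sum>x\<in>partition_vectors 1 1. EP_SM_prob \<alpha> \<theta> 1 x) = 1" and y: "y > 0"
  shows "(\<lambda>n. gamma_mixture n y) \<longlonglongrightarrow> cdf (density lborel (scaled_ML_density \<alpha> \<theta> f)) y"
proof -
  let ?r = "\<lambda>x. y powr (1 / \<alpha>) * x"
  let ?u = "\<lambda>i x. ennreal (tilted x) * ennreal (cdf (gamma_law (\<theta> + real (Suc i))) (real (Suc i) * ?r x))"
  let ?l = "\<lambda>x. ennreal (tilted x) * indicator {y powr (- (1 / \<alpha>))..} x"
  have [measurable]: "cdf (gamma_law (\<theta> + real (Suc i))) \<in> borel_measurable borel" for i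
  proof -
    interpret prob_space "gamma_law (\<theta> + real (Suc i))"
      by (rule prob_space_gamma_law) (rule shape_pos', simp)
    show ?thesis
      unfolding cdf_def by (intro borel_measurable_mono monoI finite_measure_mono) auto
  qed
  have "(\<lambda>i. \<integral>\<^sup>+x. ?u i x \<partial>lborel) \<longlonglongrightarrow> (\<integral>\<^sup>+x. ?l x \<partial>lborel)"
  proof (rule nn_integral_dominated_convergence[where w = "\<lambda>x. ennreal (tilted x)"])
    show "AE x in lborel. ?u i x \<le> ennreal (tilted x)" for i
      using cdf_gamma_law_le_1[OF shape_pos'[of "Suc i"]]
      by (intro AE_I2) (simp flip: ennreal_mult' add: tilted_nonneg mult_left_le cdf_def)
    show "(\<integral>\<^sup>+x. ennreal (tilted x) \<partial>lborel) < \<infinity>"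
      using tilted_mass[OF mass] by simp
    show "AE x in lborel. (\<lambda>i. ?u i x) \<longlonglongrightarrow> ?l x"
      using AE_lborel_singleton[of "y powr (- (1 / \<alpha>))"]
    proof eventually_elim
      case (elim x)
      have eq: "?r x = 1 \<longleftrightarrow> x = y powr (- (1 / \<alpha>))" and lt: "1 < ?r x \<longleftrightarrow> y powr (- (1 / \<alpha>)) < x"
        using y by (auto simp: powr_minus field_simps)
      have "(\<lambda>i. ?u i x) \<longlonglongrightarrow> ennreal (tilted x) * ennreal (if 1 < ?r x then 1 else 0)"
        using elim eq \<theta> \<alpha> by (intro ennreal_tendsto_cmult tendsto_ennrealI gamma_law_lln) auto
      also have "ennreal (tilted x) * ennreal (if 1 < ?r x then 1 else 0) = ?l x"
        using lt elim by (auto simp: indicator_def)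
      finally show ?case .
    qed
  qed measurable
  then have "(\<lambda>i. ennreal (gamma_mixture (Suc i) y))
      \<longlonglongrightarrow> emeasure (density lborel (scaled_ML_density \<alpha> \<theta> f)) {..y}"
    using y by (simp only: ennreal_gamma_mixture emeasure_scaled_ML)
  moreover have "emeasure (density lborel (scaled_ML_density \<alpha> \<theta> f)) {..y} < \<infinity>"
  proof -
    have "(\<integral>\<^sup>+x. ?l x \<partial>lborel) \<le> (\<integral>\<^sup>+x. ennreal (tilted x) \<partial>lborel)"
      by (intro nn_integral_mono) (auto split: split_indicator)
    then show ?thesis
      using tilted_mass[OF mass] emeasure_scaled_ML[OF y] by (auto simp: le_less_trans)
  qed
  ultimately have "(\<lambda>i. ennreal (gamma_mixture (Suc i) y))
      \<longlonglongrightarrow> ennreal (cdf (density lborel (scaled_ML_density \<alpha> \<theta> f)) y)"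
    unfolding cdf_def by (subst (asm) emeasure_eq_ennreal_measure) auto
  then have "(\<lambda>i. enn2real (ennreal (gamma_mixture (Suc i) y)))
      \<longlonglongrightarrow> cdf (density lborel (scaled_ML_density \<alpha> \<theta> f)) y"
    by (rule tendsto_enn2real) (simp add: cdf_def)
  moreover have "gamma_mixture (Suc i) y \<ge> 0" for i
    unfolding gamma_mixture_def
    by (intro sum_nonneg mult_nonneg_nonneg EP_SM_prob_nonneg) (auto simp: cdf_def)
  ultimately have "(\<lambda>i. gamma_mixture (Suc i) y) \<longlonglongrightarrow> cdf (density lborel (scaled_ML_density \<alpha> \<theta> f)) y"
    by simp
  then show ?thesis by (rule LIMSEQ_imp_Suc)
qed

text \<open>
  Let \<open>T = n powr \<alpha>\<close>. Given the number \<open>K\<close> of blocks, the Gamma variable has mean and variance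
  \<open>\<theta> / \<alpha> + K\<close>. By Chebyshev's inequality it exceeds \<open>T * (y + \<epsilon>)\<close> with probability at most \<open>\<delta>\<close>
  if \<open>K \<le> T * y\<close>, and is at most \<open>T * (y - \<epsilon>)\<close> with probability at most \<open>\<delta>\<close> if \<open>K > T * y\<close>.
\<close>

lemma block_count_cdf_bounds:
  assumes n: "n \<ge> 1" and total: "(\<Sum>x\<in>partition_vectors n n. EP_SM_prob \<alpha> \<theta> n x) = 1"
    and y: "y > 0" and \<epsilon>: "\<epsilon> > 0" and large: "\<epsilon> * real n powr \<alpha> > \<bar>\<theta> / \<alpha>\<bar>"
  defines "F \<equiv> (\<Sum>x\<in>partition_vectors n n. if real (\<Sum>i=1..n. x i) \<le> real n powr \<alpha> * y
              then EP_SM_prob \<alpha> \<theta> n x else 0)"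
    and "\<delta> \<equiv> (\<bar>\<theta> / \<alpha>\<bar> + real n powr \<alpha> * y) / (\<epsilon> * real n powr \<alpha> - \<bar>\<theta> / \<alpha>\<bar>)\<^sup>2"
  shows "F \<le> gamma_mixture n (y + \<epsilon>) + \<delta>"
    and "\<epsilon> < y \<Longrightarrow> gamma_mixture n (y - \<epsilon>) \<le> F + \<delta>"
proof -
  define N where "N = real n powr \<alpha>"
  define b where "b = \<theta> / \<alpha>"
  define K where "K x = real (\<Sum>i=1..n. x i)" for x :: "nat \<Rightarrow> nat"
  have N: "N > 0" using n by (simp add: N_def)
  have K: "b + K x > 0" if "x \<in> partition_vectors n n" for x
    unfolding K_def b_def using that n by (intro shape_pos partition_vectors_sum_pos)
  have bN: "\<bar>b\<bar> < \<epsilon> * N" using large by (simp add: b_def N_def)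
  have \<delta>: "\<delta> = (\<bar>b\<bar> + N * y) / (\<epsilon> * N - \<bar>b\<bar>)\<^sup>2" by (simp add: \<delta>_def b_def N_def)
  have sum_add_\<delta>: "(\<Sum>x\<in>partition_vectors n n. EP_SM_prob \<alpha> \<theta> n x * (h x + \<delta>))
      = (\<Sum>x\<in>partition_vectors n n. EP_SM_prob \<alpha> \<theta> n x * h x) + \<delta>" for h
    using total by (simp add: distrib_left sum.distrib flip: sum_distrib_right)
  have F: "F = (\<Sum>x\<in>partition_vectors n n. EP_SM_prob \<alpha> \<theta> n x * (if K x \<le> N * y then 1 else 0))"
    unfolding F_def K_def N_def by (intro sum.cong) auto
  have gm: "gamma_mixture n y' = (\<Sum>x\<in>partition_vectors n n. EP_SM_prob \<alpha> \<theta> n x * cdf (gamma_law (b + K x)) (N * y'))" for y'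
    unfolding gamma_mixture_def b_def N_def K_def ..
  have \<delta>_nonneg: "\<delta> \<ge> 0" unfolding \<delta> using N y by simp
  have cdf_nonneg: "cdf M t \<ge> 0" for M :: "real measure" and t by (simp add: cdf_def)
  show "F \<le> gamma_mixture n (y + \<epsilon>) + \<delta>"
    unfolding F gm sum_add_\<delta>[symmetric]
  proof (intro sum_mono mult_left_mono)
    fix x assume x: "x \<in> partition_vectors n n"
    have "1 \<le> cdf (gamma_law (b + K x)) (N * (y + \<epsilon>)) + \<delta>" if le: "K x \<le> N * y"
    proof -
      have gap: "\<epsilon> * N - \<bar>b\<bar> \<le> N * (y + \<epsilon>) - (b + K x)" using le by (simp add: algebra_simps)
      have "1 - (b + K x) / (N * (y + \<epsilon>) - (b + K x))\<^sup>2 \<le> cdf (gamma_law (b + K x)) (N * (y + \<epsilon>))"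
        using K[OF x] gap bN by (intro cdf_gamma_law_ge) auto
      moreover have "(b + K x) / (N * (y + \<epsilon>) - (b + K x))\<^sup>2 \<le> \<delta>"
        unfolding \<delta> using K[OF x] gap bN le by (intro frac_le power_mono) auto
      ultimately show ?thesis by linarith
    qed
    then show "(if K x \<le> N * y then 1 else 0) \<le> cdf (gamma_law (b + K x)) (N * (y + \<epsilon>)) + \<delta>"
      using cdf_nonneg[of "gamma_law (b + K x)" "N * (y + \<epsilon>)"] \<delta>_nonneg by simp
  qed (use n in \<open>auto intro: EP_SM_prob_nonneg\<close>)
  show "gamma_mixture n (y - \<epsilon>) \<le> F + \<delta>" if \<epsilon>y: "\<epsilon> < y"
    unfolding F gm sum_add_\<delta>[symmetric]
  proof (intro sum_mono mult_left_mono)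
    fix x assume x: "x \<in> partition_vectors n n"
    have "cdf (gamma_law (b + K x)) (N * (y - \<epsilon>)) \<le> \<delta>" if gt: "N * y < K x"
    proof -
      define U where "U = N * (y - \<epsilon>)"
      define D where "D = \<epsilon> * N - \<bar>b\<bar>"
      define m where "m = b + K x"
      have U: "U \<ge> 0" using N \<epsilon>y by (simp add: U_def)
      have D: "D > 0" using bN by (simp add: D_def)
      have mU: "D \<le> m - U" using gt by (simp add: D_def m_def U_def algebra_simps)
      have "cdf (gamma_law m) U \<le> m / (m - U)\<^sup>2"
        using K[OF x] mU D by (intro cdf_gamma_law_le) (auto simp: m_def)
      \<comment> \<open>this form decreases in \<open>m\<close>, so \<open>m - U\<close> may be replaced by its lower bound \<open>D\<close>\<close>
      also have "m / (m - U)\<^sup>2 = 1 / (m - U) + U / (m - U)\<^sup>2"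
        using mU D by (simp add: power2_eq_square divide_simps)
      also have "\<dots> \<le> 1 / D + U / D\<^sup>2"
        using mU D U by (intro add_mono frac_le power_mono) auto
      also have "\<dots> = (D + U) / D\<^sup>2"
        using D by (simp add: power2_eq_square divide_simps)
      also have "\<dots> \<le> \<delta>"
        unfolding \<delta> D_def[symmetric] using D by (intro divide_right_mono) (auto simp: D_def U_def algebra_simps)
      finally show ?thesis by (simp add: m_def U_def)
    qed
    moreover have "cdf (gamma_law (b + K x)) (N * (y - \<epsilon>)) \<le> 1"
      using K[OF x] by (rule cdf_gamma_law_le_1)
    ultimately show "cdf (gamma_law (b + K x)) (N * (y - \<epsilon>)) \<le> (if K x \<le> N * y then 1 else 0) + \<delta>"
      using \<delta>_nonneg by auto
  qed (use n in \<open>auto intro: EP_SM_prob_nonneg\<close>)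
qed

end

text \<open>
  The limit law lives on the positive half-line and \<open>K \<ge> 1\<close>, so only \<open>y > 0\<close> needs the Gamma mixture,
  which has the right limit and is close to \<open>K\<close>.
\<close>

theorem EP_SM_weak_limit:
  assumes "0 < \<alpha>" "\<alpha> < 1" "\<theta> > - \<alpha>" "positive_stable_density \<alpha> f"
    and pmf: "\<And>n. n \<ge> 1 \<Longrightarrow> has_joint_pmf n (P n) (M n) (EP_SM_prob \<alpha> \<theta> n)"
  shows "weak_conv_m
          (\<lambda>n. distr (P n) borel (\<lambda>\<omega>. real (\<Sum>r=1..n. M n r \<omega>) / real n powr \<alpha>))
          (density lborel (scaled_ML_density \<alpha> \<theta> f))"
  unfolding weak_conv_m_def weak_conv_def
proof (intro allI impI)
  fix y :: real
  interpret stable_mixture \<alpha> \<theta> f using assms by unfold_locales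
  let ?G = "cdf (density lborel (scaled_ML_density \<alpha> \<theta> f))"
  let ?F = "\<lambda>n. cdf (distr (P n) borel (\<lambda>\<omega>. real (\<Sum>r=1..n. M n r \<omega>) / real n powr \<alpha>)) y"
  assume cont: "isCont ?G y"
  have F: "?F n = (\<Sum>x\<in>partition_vectors n n. if real (\<Sum>i=1..n. x i) \<le> real n powr \<alpha> * y
              then EP_SM_prob \<alpha> \<theta> n x else 0)" if "n \<ge> 1" for n
    using that by (intro cdf_block_count[OF pmf]) (auto simp: EP_SM_prob_def)
  have total: "(\<Sum>x\<in>partition_vectors n n. EP_SM_prob \<alpha> \<theta> n x) = 1" if "n \<ge> 1" for n
    using that by (intro sum_joint_pmf_eq_1[OF pmf]) (auto simp: EP_SM_prob_def)
  show "?F \<longlonglongrightarrow> ?G y"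
  proof (cases "y > 0")
    case False
    have "?F n = 0" if "n \<ge> 1" for n
    proof -
      have "\<not> real (\<Sum>i=1..n. x i) \<le> real n powr \<alpha> * y" if "x \<in> partition_vectors n n" for x
      proof -
        have "real 1 \<le> real (\<Sum>i=1..n. x i)"
          by (rule of_nat_mono) (rule partition_vectors_sum_pos[OF that \<open>n \<ge> 1\<close>])
        moreover have "real n powr \<alpha> * y \<le> 0"
          using False by (intro mult_nonneg_nonpos) auto
        ultimately show ?thesis by (simp del: of_nat_sum)
      qed
      then show ?thesis unfolding F[OF that] by (intro sum.neutral) auto
    qed
    moreover have "?G y = 0"
    proof -
      have [measurable]: "scaled_ML_density \<alpha> \<theta> f \<in> borel_measurable borel"
        unfolding scaled_ML_density_def[abs_def] by measurable
      have "emeasure (density lborel (scaled_ML_density \<alpha> \<theta> f)) {..y}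
         = (\<integral>\<^sup>+s. ennreal (scaled_ML_density \<alpha> \<theta> f s) * indicator {..y} s \<partial>lborel)"
        by (subst emeasure_density) auto
      also have "\<dots> = (\<integral>\<^sup>+s. 0 \<partial>(lborel :: real measure))"
        using False by (intro nn_integral_cong) (auto simp: scaled_ML_density_def split: split_indicator)
      finally show ?thesis by (simp add: cdf_def measure_def)
    qed
    ultimately show ?thesis
      by (intro tendsto_eventually) (auto simp: eventually_sequentially)
  next
    case y: True
    define \<delta> where "\<delta> \<epsilon> n = (\<bar>\<theta> / \<alpha>\<bar> + real n powr \<alpha> * y) / (\<epsilon> * real n powr \<alpha> - \<bar>\<theta> / \<alpha>\<bar>)\<^sup>2" for \<epsilon> and n :: nat
    have powr_top: "filterlim (\<lambda>n. real n powr \<alpha>) at_top sequentially"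
      using assms(1) by real_asymp
    have \<delta>: "\<delta> \<epsilon> \<longlonglongrightarrow> 0" if "\<epsilon> > 0" for \<epsilon>
    proof -
      have "((\<lambda>N. (\<bar>\<theta> / \<alpha>\<bar> + N * y) / (\<epsilon> * N - \<bar>\<theta> / \<alpha>\<bar>)\<^sup>2) \<longlongrightarrow> 0) at_top"
        using that y by real_asymp
      then show ?thesis unfolding \<delta>_def by (rule filterlim_compose[OF _ powr_top])
    qed
    have large: "\<forall>\<^sub>F n in sequentially. n \<ge> 1 \<and> \<epsilon> * real n powr \<alpha> > \<bar>\<theta> / \<alpha>\<bar>" if "\<epsilon> > 0" for \<epsilon>
    proof -
      have "filterlim (\<lambda>n. \<epsilon> * real n powr \<alpha>) at_top sequentially"
        using that by (intro filterlim_tendsto_pos_mult_at_top[OF tendsto_const _ powr_top])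
      then show ?thesis
        by (intro eventually_conj eventually_ge_at_top) (auto simp: filterlim_at_top_dense)
    qed
    show ?thesis
    proof (rule tendsto_sandwich_isCont[OF cont y])
      fix \<epsilon> :: real assume \<epsilon>: "\<epsilon> > 0"
      have "(\<lambda>n. gamma_mixture n (y + \<epsilon>) + \<delta> \<epsilon> n) \<longlonglongrightarrow> ?G (y + \<epsilon>) + 0"
        using \<epsilon> y total by (intro tendsto_add gamma_mixture_limit \<delta>) auto
      moreover have "\<forall>\<^sub>F n in sequentially. ?F n \<le> gamma_mixture n (y + \<epsilon>) + \<delta> \<epsilon> n"
        using large[OF \<epsilon>]
      proof eventually_elim
        case (elim n)
        then show ?case
          unfolding \<delta>_def F[OF conjunct1[OF elim]] using \<epsilon> y total by (intro block_count_cdf_bounds(1)) auto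
      qed
      ultimately show "\<exists>u. u \<longlonglongrightarrow> ?G (y + \<epsilon>) \<and> (\<forall>\<^sub>F n in sequentially. ?F n \<le> u n)"
        unfolding add_0_right by (intro exI conjI)
    next
      fix \<epsilon> :: real assume \<epsilon>: "0 < \<epsilon>" "\<epsilon> < y"
      have "(\<lambda>n. gamma_mixture n (y - \<epsilon>) - \<delta> \<epsilon> n) \<longlonglongrightarrow> ?G (y - \<epsilon>) - 0"
        using \<epsilon> total by (intro tendsto_diff gamma_mixture_limit \<delta>) auto
      moreover have "\<forall>\<^sub>F n in sequentially. gamma_mixture n (y - \<epsilon>) - \<delta> \<epsilon> n \<le> ?F n"
        using large[OF \<epsilon>(1)]
      proof eventually_elim
        case (elim n)
        have "gamma_mixture n (y - \<epsilon>) \<le> ?F n + \<delta> \<epsilon> n"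
          unfolding \<delta>_def F[OF conjunct1[OF elim]] using elim \<epsilon> y total by (intro block_count_cdf_bounds(2)) auto
        then show ?case by simp
      qed
      ultimately show "\<exists>l. l \<longlonglongrightarrow> ?G (y - \<epsilon>) \<and> (\<forall>\<^sub>F n in sequentially. l n \<le> ?F n)"
        unfolding diff_zero by (intro exI conjI)
    qed
  qed
qed

section \<open>Coefficients of the compound Poisson series\<close>

text \<open>
  The expansion of \<open>(1 - t) powr (- a) - 1\<close>, the negative of \<open>sibuya_fps (- a)\<close>; for \<open>a > 0\<close> it has
  nonnegative coefficients.
\<close>

definition neg_binomial_fps :: "real \<Rightarrow> real fps" where
  "neg_binomial_fps a = Abs_fps (\<lambda>i. if i = 0 then 0 else pochhammer a i / fact i)"

text \<open>
  The coefficient of \<open>t ^ n\<close> in \<open>exp (u * ((1 - t) powr (- a) - 1))\<close>.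
\<close>

definition nb_coeff :: "real \<Rightarrow> real \<Rightarrow> nat \<Rightarrow> real" where
  "nb_coeff a u n = fps_nth (fps_exp 1 oo (fps_const u * neg_binomial_fps a)) n"

lemma neg_binomial_fps_0 [simp]: "fps_nth (neg_binomial_fps a) 0 = 0"
  by (simp add: neg_binomial_fps_def)

lemma neg_binomial_fps_power_nonneg:
  assumes "a > 0"
  shows "fps_nth (neg_binomial_fps a ^ j) n \<ge> 0"
proof (induction j arbitrary: n)
  case (Suc j)
  have "fps_nth (neg_binomial_fps a) i \<ge> 0" for i
    using assms by (auto simp: neg_binomial_fps_def intro!: divide_nonneg_pos pochhammer_nonneg)
  with Suc show ?case by (auto simp: fps_mult_nth intro!: sum_nonneg)
qed (auto simp: fps_one_nth)

lemma nb_coeff_eq_sum: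
  "nb_coeff a u n = (\<Sum>j=0..n. u ^ j / fact j * fps_nth (neg_binomial_fps a ^ j) n)"
  by (simp add: nb_coeff_def fps_compose_nth power_mult_distrib)

text \<open>
  The powers of \<open>neg_binomial_fps a\<close> have nonnegative coefficients, so each term of the convergent
  series at \<open>t\<close> is at most its sum.
\<close>

lemma nb_coeff_upper:
  assumes a: "a > 0" and u: "u \<ge> 0" and t: "0 < t" "t < 1"
  shows "nb_coeff a u n * t ^ n \<le> exp (u * ((1 - t) powr (- a) - 1))"
proof -
  let ?V = "neg_binomial_fps a"
  define B where "B = (1 - t) powr (- a) - 1"
  have sums: "(\<lambda>n. fps_nth ?V n * s ^ n) sums ((1 - s) powr (- a) - 1)" if "\<bar>s\<bar> < 1" for s
  proof -
    have "(\<lambda>n. (if n = 0 then 1 else 0) * s ^ n) sums 1"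
      using powser_sums_if[of 0 s] by simp
    moreover have "(\<lambda>n. pochhammer (- (- a)) n / fact n * s ^ n) sums (1 - s) powr (- a)"
      using that by (rule pochhammer_sums)
    ultimately have "(\<lambda>n. pochhammer (- (- a)) n / fact n * s ^ n - (if n = 0 then 1 else 0) * s ^ n)
        sums ((1 - s) powr (- a) - 1)"
      by (rule sums_diff[rotated])
    also have "(\<lambda>n. pochhammer (- (- a)) n / fact n * s ^ n - (if n = 0 then 1 else 0) * s ^ n)
        = (\<lambda>n. fps_nth ?V n * s ^ n)"
      by (auto simp: neg_binomial_fps_def)
    finally show ?thesis .
  qed
  have "ereal (norm ((1 + t) / 2)) \<le> fps_conv_radius ?V"
    unfolding fps_conv_radius_def using t
    by (intro conv_radius_geI sums_summable[OF sums]) auto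
  moreover have "ereal (norm t) < ereal (norm ((1 + t) / 2))" using t by simp
  ultimately have R: "norm t < fps_conv_radius ?V" by (rule less_le_trans[rotated])
  have B: "eval_fps ?V t = B"
    using sums[of t] t by (simp add: eval_fps_def B_def sums_iff)
  have bound: "fps_nth (?V ^ j) n * t ^ n \<le> B ^ j" for j
  proof -
    have "norm t < fps_conv_radius (?V ^ j)"
      using R fps_conv_radius_power by (rule less_le_trans)
    then have "summable (\<lambda>n. fps_nth (?V ^ j) n * t ^ n)" by (rule summable_fps)
    then have "(\<Sum>i\<in>{n}. fps_nth (?V ^ j) i * t ^ i) \<le> (\<Sum>i. fps_nth (?V ^ j) i * t ^ i)"
      using t by (intro sum_le_suminf) (auto intro!: mult_nonneg_nonneg neg_binomial_fps_power_nonneg a)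
    also have "\<dots> = eval_fps (?V ^ j) t" by (simp add: eval_fps_def)
    also have "\<dots> = B ^ j" using R by (simp add: eval_fps_power B)
    finally show ?thesis by simp
  qed
  have B0: "B \<ge> 0" using bound[of 1] t a neg_binomial_fps_power_nonneg[OF a, of 1 n]
    by (intro order_trans[OF _ bound[of 1, simplified]]) auto
  have "nb_coeff a u n * t ^ n = (\<Sum>j=0..n. u ^ j / fact j * (fps_nth (?V ^ j) n * t ^ n))"
    by (simp add: nb_coeff_eq_sum sum_distrib_right mult.assoc)
  also have "\<dots> \<le> (\<Sum>j=0..n. u ^ j / fact j * B ^ j)"
    using u by (intro sum_mono mult_left_mono bound) auto
  also have "\<dots> = (\<Sum>j=0..n. (u * B) ^ j /\<^sub>R fact j)"
    by (intro sum.cong) (auto simp: power_mult_distrib divide_inverse)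
  also have "\<dots> \<le> exp (u * B)"
    using exp_converges[of "u * B"] u B0 sum_le_suminf[of "\<lambda>j. (u * B) ^ j /\<^sub>R fact j" "{0..n}"]
    by (simp add: sums_iff)
  finally show ?thesis by (simp add: B_def)
qed

text \<open>
  Formally \<open>exp (y * ((1 - t) powr (- a) - 1))\<close> is the mixture of the series \<open>(1 - t) powr (- (a * k))\<close>
  over a Poisson variable \<open>k\<close> with mean \<open>y\<close>; the bound keeps one value of \<open>k\<close>. The proof expands
  \<open>(1 + V) ^ k\<close> binomially and compares the coefficient of each power of \<open>V\<close>, where \<open>1 + V\<close> stands for
  \<open>(1 - t) powr (- a)\<close>.
\<close>

lemma nb_coeff_lower:
  assumes a: "a > 0" and y: "y \<ge> 0"
  shows "exp (- y) * (y ^ k / fact k) * (pochhammer (a * real k) n / fact n) \<le> nb_coeff a y n"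
proof -
  let ?V = "neg_binomial_fps a"
  have P: "1 + ?V = fps_binomial (- a) oo (fps_const (- 1) * fps_X)"
    unfolding fps_compose_linear
    by (auto simp: fps_eq_iff neg_binomial_fps_def gbinomial_pochhammer simp flip: power_mult_distrib)
  have "(1 + ?V) ^ k = fps_binomial (real k * - a) oo (fps_const (- 1) * fps_X)"
    unfolding P by (subst fps_compose_power) (simp_all add: fps_binomial_power)
  then have "fps_nth ((1 + ?V) ^ k) n = pochhammer (a * real k) n / fact n"
    unfolding fps_compose_linear
    by (simp add: gbinomial_pochhammer mult.commute flip: power_mult_distrib)
  moreover have "(1 + ?V) ^ k = (\<Sum>j\<le>k. of_nat (k choose j) * ?V ^ j)"
    using binomial_ring[of ?V 1 k] by (simp add: add.commute)
  ultimately have P: "pochhammer (a * real k) n / fact n = (\<Sum>j\<le>k. real (k choose j) * fps_nth (?V ^ j) n)"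
    by (simp add: fps_sum_nth fps_of_nat[symmetric])
  have pow: "y ^ i / fact i \<le> exp y" for i
    using exp_converges[of y] y sum_le_suminf[of "\<lambda>j. y ^ j /\<^sub>R fact j" "{i}"]
    by (simp add: sums_iff divide_inverse mult.commute)
  have "(y ^ k / fact k) * (pochhammer (a * real k) n / fact n)
      = (\<Sum>j\<le>k. (y ^ (k - j) / fact (k - j)) * (y ^ j / fact j * fps_nth (?V ^ j) n))"
    unfolding P sum_distrib_left
  proof (intro sum.cong refl)
    fix j assume "j \<in> {..k}"
    then have j: "j \<le> k" by simp
    have "y ^ k = y ^ (k - j) * y ^ j" using j by (simp flip: power_add)
    then show "y ^ k / fact k * (real (k choose j) * fps_nth (?V ^ j) n)
      = y ^ (k - j) / fact (k - j) * (y ^ j / fact j * fps_nth (?V ^ j) n)"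
      using j by (simp add: binomial_fact field_simps)
  qed
  also have "\<dots> \<le> (\<Sum>j\<le>k. exp y * (y ^ j / fact j * fps_nth (?V ^ j) n))"
    using y by (intro sum_mono mult_right_mono pow mult_nonneg_nonneg neg_binomial_fps_power_nonneg a) auto
  also have "\<dots> = (\<Sum>j\<in>{..k} \<inter> {0..n}. exp y * (y ^ j / fact j * fps_nth (?V ^ j) n))"
    by (intro sum.mono_neutral_right) (auto simp: startsby_zero_power_prefix[rule_format] not_le)
  also have "\<dots> \<le> (\<Sum>j=0..n. exp y * (y ^ j / fact j * fps_nth (?V ^ j) n))"
    using y by (intro sum_mono2 mult_nonneg_nonneg neg_binomial_fps_power_nonneg a) auto
  also have "\<dots> = exp y * nb_coeff a y n"
    by (simp add: nb_coeff_eq_sum sum_distrib_left)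
  finally show ?thesis by (simp add: exp_minus field_simps)
qed

text \<open>
  Stirling's upper bound up to a factor of order \<open>k powr (1 / 2)\<close>; the induction step is
  \<open>ln (1 + 1 / k) \<ge> 1 / (k + 1)\<close>.
\<close>

lemma ln_fact_upper:
  assumes "k \<ge> 1"
  shows "ln (fact k :: real) \<le> (real k + 1) * ln (real k) - real k + 1"
  using assms
proof (induction k rule: dec_induct)
  case (step k)
  have k: "real k > 0" using step by simp
  have "- ln (1 - 1 / (real k + 1)) \<ge> 1 / (real k + 1)"
    using k ln_add_one_self_le_self2[of "- 1 / (real k + 1)"] by simp
  also have "1 - 1 / (real k + 1) = real k / (real k + 1)" using k by (simp add: field_simps)
  also have "- ln (real k / (real k + 1)) = ln (real k + 1) - ln (real k)"
    using k by (simp add: ln_div)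
  finally have "1 \<le> (real k + 1) * (ln (real k + 1) - ln (real k))"
    using k by (simp add: field_simps)
  moreover have "ln (fact (Suc k) :: real) = ln (real k + 1) + ln (fact k)"
    by (simp add: ln_mult add.commute del: of_nat_Suc)
  ultimately show ?case using step.IH by (simp add: algebra_simps)
qed simp

lemma pochhammer_mono:
  fixes x y :: real
  assumes "0 \<le> x" "x \<le> y"
  shows "pochhammer x n \<le> pochhammer y n"
  unfolding pochhammer_prod using assms by (intro prod_mono) auto

lemma pochhammer_Suc_of_nat: "pochhammer (real (Suc j)) n * fact j = fact (n + j)"
proof (induction n)
  case (Suc n)
  have "pochhammer (real (Suc j)) (Suc n) * fact j
      = (real (Suc j) + real n) * (pochhammer (real (Suc j)) n * fact j)"
    by (simp add: pochhammer_Suc)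
  also have "\<dots> = fact (Suc n + j)"
    unfolding Suc by (simp add: algebra_simps)
  finally show ?case .
qed simp

lemma fact_power_le: "fact n * n ^ j \<le> (fact (n + j) :: nat)"
proof (induction j)
  case (Suc j)
  have "fact n * n ^ Suc j = n * (fact n * n ^ j)" by simp
  also have "\<dots> \<le> Suc (n + j) * fact (n + j)" using Suc by (intro mult_mono) auto
  finally show ?case by simp
qed simp

text \<open>
  For \<open>x = m\<close> the right side is \<open>(n + m - 1)! / (n! * (m - 1)!)\<close>, and \<open>real m / fact m\<close> is
  \<open>1 / (m - 1)!\<close>.
\<close>

lemma pochhammer_lower:
  assumes "m \<ge> 1" "real m \<le> x"
  shows "real n ^ (m - 1) * (real m / fact m) \<le> pochhammer x n / fact n"
proof -
  obtain j where m: "m = Suc j" using assms(1) by (cases m) auto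
  have "real (fact n * n ^ j) \<le> real (fact (n + j))"
    using fact_power_le by (rule of_nat_mono)
  then have "fact n * real n ^ j \<le> pochhammer (real m) n * fact j"
    by (simp add: m pochhammer_Suc_of_nat del: of_nat_Suc)
  then have "real n ^ j / fact j \<le> pochhammer (real m) n / fact n"
    by (simp add: field_simps)
  also have "\<dots> \<le> pochhammer x n / fact n"
    using assms by (intro divide_right_mono pochhammer_mono) auto
  finally show ?thesis by (simp add: m del: of_nat_Suc)
qed

lemma ln_nb_coeff_lower:
  assumes a: "a > 0" and y: "y > 0" and n: "n \<ge> 1" and m: "m \<ge> 1" and k: "k \<ge> 1" and mk: "real m \<le> a * real k"
  shows "nb_coeff a y n > 0"
    and "- y + real k * ln y - (real k + 1) * ln (real k) + real k - 1
       + (real m - 1) * ln (real n) - real m * ln (real m) + real m - 1 \<le> ln (nb_coeff a y n)"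
proof -
  define L where "L = exp (- y) * (y ^ k / fact k) * (real n ^ (m - 1) * (real m / fact m))"
  have L: "L > 0" using y n m by (simp add: L_def)
  have "L \<le> exp (- y) * (y ^ k / fact k) * (pochhammer (a * real k) n / fact n)"
    unfolding L_def using y pochhammer_lower[OF m mk] by (intro mult_left_mono) auto
  also have "\<dots> \<le> nb_coeff a y n" using a y by (intro nb_coeff_lower) auto
  finally have le: "L \<le> nb_coeff a y n" .
  with L show pos: "nb_coeff a y n > 0" by linarith
  have "ln L = - y + (real k * ln y - ln (fact k)) + ((real m - 1) * ln (real n) + (ln (real m) - ln (fact m)))"
    unfolding L_def using y n m by (simp add: ln_mult ln_div ln_realpow of_nat_diff)
  moreover have "ln (fact k :: real) \<le> (real k + 1) * ln (real k) - real k + 1"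
    using k by (rule ln_fact_upper)
  moreover have "ln (fact m :: real) \<le> (real m + 1) * ln (real m) - real m + 1"
    using m by (rule ln_fact_upper)
  moreover have "ln L \<le> ln (nb_coeff a y n)" using le L pos by simp
  ultimately show "- y + real k * ln y - (real k + 1) * ln (real k) + real k - 1
       + (real m - 1) * ln (real n) - real m * ln (real m) + real m - 1 \<le> ln (nb_coeff a y n)"
    by (simp add: algebra_simps)
qed

section \<open>Growth rate of the coefficients\<close>

text \<open>
  The minimum of \<open>r + u * r powr (- a)\<close> over \<open>r > 0\<close>, attained at \<open>r = (a * u) powr (1 / (1 + a))\<close>.
  It is the limit of \<open>ln (nb_coeff a u n) / n powr (a / (1 + a))\<close>.
\<close>

definition saddle_rate :: "real \<Rightarrow> real \<Rightarrow> real" where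
  "saddle_rate a u = (1 + 1 / a) * (a * u) powr (1 / (1 + a))"

text \<open>
  Use the upper bound at \<open>t = 1 - r\<close>. With \<open>r = \<rho> * n powr (- g)\<close> and \<open>g = 1 / (1 + a)\<close> the exponent
  is about \<open>n * r + u * r powr (- a)\<close>, where both terms have the order \<open>n powr (1 - g)\<close>.
\<close>

lemma nb_coeff_upper_rate:
  assumes a: "a > 0" and u: "u > 0"
  shows "\<exists>U. (\<forall>\<^sub>F n in sequentially. nb_coeff a u n \<le> exp (U n)) \<and>
    (\<lambda>n. U n / real n powr (a / (1 + a))) \<longlonglongrightarrow> saddle_rate a u"
proof -
  define g where "g = 1 / (1 + a)"
  have g: "0 < g" "g < 1" using a by (auto simp: g_def)
  have \<beta>: "a / (1 + a) = 1 - g" and ag: "a * g = 1 - g" using a by (auto simp: g_def field_simps)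
  define \<rho> where "\<rho> = (a * u) powr g"
  have \<rho>: "\<rho> > 0" using a u by (simp add: \<rho>_def)
  have \<rho>a: "u * \<rho> powr (- a) = \<rho> / a"
  proof -
    have "\<rho> powr (1 + a) = a * u" using a u by (simp add: \<rho>_def powr_powr g_def)
    then have "\<rho> * \<rho> powr a = a * u" using \<rho> by (simp add: powr_add)
    then show ?thesis using \<rho> a by (simp add: powr_minus field_simps)
  qed
  define r where "r n = \<rho> * real n powr (- g)" for n :: nat
  define U where "U n = - real n * ln (1 - r n) + u * (r n powr (- a) - 1)" for n
  \<comment> \<open>the bound at \<open>t = 1 - r\<close> requires \<open>r < 1\<close>\<close>
  have "\<forall>\<^sub>F n in sequentially. r n < 1"
    unfolding r_def using g \<rho> by real_asymp
  then have "\<forall>\<^sub>F n in sequentially. nb_coeff a u n \<le> exp (U n)"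
    using eventually_ge_at_top[of 1]
  proof eventually_elim
    case (elim n)
    have r: "0 < r n" "r n < 1" using elim \<rho> by (auto simp: r_def)
    have "nb_coeff a u n * (1 - r n) ^ n \<le> exp (u * ((1 - (1 - r n)) powr (- a) - 1))"
      using a u r by (intro nb_coeff_upper) auto
    moreover have "(1 - r n) ^ n = exp (real n * ln (1 - r n))"
      using r by (simp add: exp_of_nat_mult)
    moreover have "U n = u * ((1 - (1 - r n)) powr (- a) - 1) - real n * ln (1 - r n)"
      by (simp add: U_def)
    ultimately show ?case
      by (simp only: exp_diff pos_le_divide_eq exp_gt_zero)
  qed
  moreover have "(\<lambda>n. U n / real n powr (1 - g)) \<longlonglongrightarrow> \<rho> + \<rho> / a"
  proof -
    have "(\<lambda>n. - real n * ln (1 - \<rho> * real n powr (- g)) / real n powr (1 - g)) \<longlonglongrightarrow> \<rho>"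
      using g \<rho> by real_asymp
    moreover have "(\<lambda>n. u / real n powr (1 - g)) \<longlonglongrightarrow> 0"
      using g by real_asymp
    ultimately have "(\<lambda>n. - real n * ln (1 - \<rho> * real n powr (- g)) / real n powr (1 - g) + \<rho> / a - u / real n powr (1 - g))
      \<longlonglongrightarrow> \<rho> + \<rho> / a - 0"
      by (intro tendsto_add tendsto_diff tendsto_const)
    moreover have "\<forall>\<^sub>F n in sequentially. - real n * ln (1 - \<rho> * real n powr (- g)) / real n powr (1 - g) + \<rho> / a - u / real n powr (1 - g)
      = U n / real n powr (1 - g)"
      using eventually_ge_at_top[of 1]
    proof eventually_elim
      case (elim n)
      have "r n powr (- a) = \<rho> powr (- a) * real n powr (1 - g)"
        using \<rho> elim ag by (simp add: r_def powr_mult powr_powr mult.commute)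
      then have "u * (r n powr (- a) - 1) = \<rho> / a * real n powr (1 - g) - u"
        using \<rho>a by (simp add: right_diff_distrib flip: mult.assoc)
      then show ?case using elim by (simp add: U_def r_def add_divide_distrib diff_divide_distrib)
    qed
    ultimately show ?thesis by (simp add: tendsto_cong)
  qed
  moreover have "saddle_rate a u = \<rho> + \<rho> / a"
    by (simp add: saddle_rate_def \<rho>_def g_def algebra_simps)
  ultimately show ?thesis unfolding \<beta> by auto
qed

text \<open>
  Use the lower bound at the dominant term, \<open>k\<close> close to \<open>\<rho> / a * n powr (a / (1 + a))\<close>, where \<open>\<rho>\<close>
  is the minimiser in \<open>saddle_rate\<close>. Both \<open>k\<close> and the integer \<open>m\<close> that replaces \<open>a * k\<close> are rounded
  such that \<open>m \<le> a * k\<close>, and \<open>m - a * k\<close> stays bounded; the coefficient of \<open>ln n\<close> in the logarithm of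
  the lower bound is therefore bounded.
\<close>

lemma nb_coeff_lower_rate:
  assumes a: "a > 0" and y: "y > 0"
  shows "\<exists>L. (\<forall>\<^sub>F n in sequentially. exp (L n) \<le> nb_coeff a y n) \<and>
    (\<lambda>n. L n / real n powr (a / (1 + a))) \<longlonglongrightarrow> saddle_rate a y"
proof -
  define g where "g = 1 / (1 + a)"
  have g: "0 < g" "g < 1" using a by (auto simp: g_def)
  have \<beta>: "a / (1 + a) = 1 - g" and ag: "a * g = 1 - g" using a by (auto simp: g_def field_simps)
  define \<rho> where "\<rho> = (a * y) powr g"
  have \<rho>: "\<rho> > 0" using a y by (simp add: \<rho>_def)
  have ln_\<rho>: "(1 + a) * ln \<rho> = ln a + ln y"
    using a y by (simp add: \<rho>_def ln_powr g_def ln_mult)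
  define N where "N n = real n powr (1 - g)" for n :: nat
  have N_top: "filterlim N at_top sequentially"
    unfolding N_def using g by real_asymp
  define m where "m n = nat \<lfloor>\<rho> * N n\<rfloor>" for n
  define k where "k n = nat \<lceil>real (m n) / a\<rceil>" for n
  have m_bounds: "\<rho> * N n - 1 \<le> real (m n)" "real (m n) \<le> \<rho> * N n" for n
  proof -
    have "\<rho> * N n \<ge> 0" using \<rho> by (simp add: N_def)
    then show "\<rho> * N n - 1 \<le> real (m n)" "real (m n) \<le> \<rho> * N n" by (auto simp: m_def)
  qed
  have k_bounds: "real (m n) / a \<le> real (k n)" "real (k n) \<le> real (m n) / a + 1" for n
  proof -
    have "real (m n) / a \<ge> 0" using a by simp
    then show "real (m n) / a \<le> real (k n)" "real (k n) \<le> real (m n) / a + 1" unfolding k_def by linarith+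
  qed
  define \<mu> where "\<mu> n = real (m n) / N n" for n
  define \<kappa> where "\<kappa> n = real (k n) / N n" for n
  have inv_N: "(\<lambda>n. 1 / N n) \<longlonglongrightarrow> 0"
    using tendsto_inverse_0_at_top[OF N_top] by (simp add: inverse_eq_divide)
  have N_pos: "\<forall>\<^sub>F n in sequentially. N n > 0"
    using N_top by (auto simp: filterlim_at_top_dense)
  have \<mu>: "\<mu> \<longlonglongrightarrow> \<rho>"
  proof (rule tendsto_sandwich)
    show "\<forall>\<^sub>F n in sequentially. \<rho> - 1 / N n \<le> \<mu> n"
      using N_pos
    proof eventually_elim
      case (elim n)
      then have "(\<rho> * N n - 1) / N n \<le> \<mu> n"
        unfolding \<mu>_def using m_bounds(1) by (intro divide_right_mono) auto
      with elim show ?case by (simp add: diff_divide_distrib)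
    qed
    show "\<forall>\<^sub>F n in sequentially. \<mu> n \<le> \<rho>"
      using N_pos by eventually_elim (use m_bounds(2) in \<open>simp add: \<mu>_def field_simps\<close>)
    show "(\<lambda>n. \<rho> - 1 / N n) \<longlonglongrightarrow> \<rho>" using tendsto_diff[OF tendsto_const inv_N, of \<rho>] by simp
  qed simp
  have \<kappa>: "\<kappa> \<longlonglongrightarrow> \<rho> / a"
  proof (rule tendsto_sandwich)
    show "\<forall>\<^sub>F n in sequentially. \<mu> n / a \<le> \<kappa> n"
      using N_pos by eventually_elim (use k_bounds(1) a in \<open>simp add: \<mu>_def \<kappa>_def field_simps\<close>)
    show "\<forall>\<^sub>F n in sequentially. \<kappa> n \<le> \<mu> n / a + 1 / N n"
      using N_pos by eventually_elim (use k_bounds(2) a in \<open>simp add: \<mu>_def \<kappa>_def field_simps\<close>)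
    show "(\<lambda>n. \<mu> n / a) \<longlonglongrightarrow> \<rho> / a" using a by (intro tendsto_divide \<mu> tendsto_const) simp
    show "(\<lambda>n. \<mu> n / a + 1 / N n) \<longlonglongrightarrow> \<rho> / a"
      using a tendsto_add[OF tendsto_divide[OF \<mu> tendsto_const, of a] inv_N] by simp
  qed
  define L where "L n = - y + real (k n) * ln y - (real (k n) + 1) * ln (real (k n)) + real (k n) - 1
       + (real (m n) - 1) * ln (real n) - real (m n) * ln (real (m n)) + real (m n) - 1" for n
  have "\<forall>\<^sub>F n in sequentially. 1 / N n < \<rho>" using order_tendstoD(2)[OF inv_N \<rho>] .
  then have large: "\<forall>\<^sub>F n in sequentially. m n \<ge> 1 \<and> k n \<ge> 1 \<and> n \<ge> 1 \<and> N n > 0"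
    using N_pos eventually_ge_at_top[of 1]
  proof eventually_elim
    case (elim n)
    then have "1 < \<rho> * N n" by (simp add: field_simps)
    then have "m n \<ge> 1" by (simp add: m_def le_nat_iff)
    moreover from this have "real (k n) > 0" using k_bounds(1)[of n] a
      by (intro less_le_trans[OF _ k_bounds(1)]) auto
    ultimately show ?case using elim by auto
  qed
  then have "\<forall>\<^sub>F n in sequentially. exp (L n) \<le> nb_coeff a y n"
  proof eventually_elim
    case (elim n)
    have "real (m n) \<le> a * real (k n)" using k_bounds(1)[of n] a by (simp add: field_simps)
    with ln_nb_coeff_lower[OF a y, of n "m n" "k n"] elim
    have "nb_coeff a y n > 0" "L n \<le> ln (nb_coeff a y n)" by (auto simp: L_def)
    then show ?case by (metis exp_le_cancel_iff exp_ln)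
  qed
  moreover have "(\<lambda>n. L n / N n) \<longlonglongrightarrow> saddle_rate a y"
  proof -
    \<comment> \<open>\<open>R\<close> collects the terms with \<open>ln n\<close> after writing \<open>ln k = ln \<kappa> + (1 - g) * ln n\<close>, likewise \<open>ln m\<close>\<close>
    define R where "R n = (g * (real (m n) - a * real (k n)) - 1) * (ln (real n) / N n)" for n
    define T where "T n = (- y - 2) * (1 / N n) + \<kappa> n * ln y - \<kappa> n * ln (\<kappa> n)
       - (ln (\<kappa> n) * (1 / N n) + (1 - g) * (ln (real n) / N n)) + \<kappa> n + \<mu> n - \<mu> n * ln (\<mu> n) + R n" for n
    have lnN: "(\<lambda>n. ln (real n) / N n) \<longlonglongrightarrow> 0"
      unfolding N_def using g by real_asymp
    have R: "R \<longlonglongrightarrow> 0"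
      unfolding R_def
    proof (rule Lim_null_comparison[OF _ tendsto_mult_right_zero[OF tendsto_norm_zero[OF lnN], of "g * a + 1"]])
      show "\<forall>\<^sub>F n in sequentially. norm ((g * (real (m n) - a * real (k n)) - 1) * (ln (real n) / N n))
        \<le> (g * a + 1) * norm (ln (real n) / N n)"
      proof (intro always_eventually allI)
        fix n
        have "- a \<le> real (m n) - a * real (k n)" "real (m n) - a * real (k n) \<le> 0"
          using k_bounds[of n] a by (simp_all add: field_simps)
        then have "g * (- a) \<le> g * (real (m n) - a * real (k n))" "g * (real (m n) - a * real (k n)) \<le> g * 0"
          using g by (intro mult_left_mono; simp)+
        then have "\<bar>g * (real (m n) - a * real (k n)) - 1\<bar> \<le> g * a + 1" by (simp add: abs_if)
        then show "norm ((g * (real (m n) - a * real (k n)) - 1) * (ln (real n) / N n))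
        \<le> (g * a + 1) * norm (ln (real n) / N n)"
          unfolding norm_mult by (intro mult_right_mono) auto
      qed
    qed
    have "T \<longlonglongrightarrow> (- y - 2) * 0 + \<rho> / a * ln y - \<rho> / a * ln (\<rho> / a)
       - (ln (\<rho> / a) * 0 + (1 - g) * 0) + \<rho> / a + \<rho> - \<rho> * ln \<rho> + 0"
      unfolding T_def using a \<rho> by (intro tendsto_intros \<kappa> \<mu> inv_N lnN R) auto
    also have "(- y - 2) * 0 + \<rho> / a * ln y - \<rho> / a * ln (\<rho> / a)
       - (ln (\<rho> / a) * 0 + (1 - g) * 0) + \<rho> / a + \<rho> - \<rho> * ln \<rho> + 0
       = \<rho> / a * (ln y + ln a - (1 + a) * ln \<rho>) + (1 + 1 / a) * \<rho>"
      using a \<rho> by (simp add: ln_div field_simps)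
    also have "\<dots> = saddle_rate a y"
      unfolding ln_\<rho> by (simp add: saddle_rate_def \<rho>_def g_def)
    finally have "T \<longlonglongrightarrow> saddle_rate a y" .
    moreover have "\<forall>\<^sub>F n in sequentially. T n = L n / N n"
      using large
    proof eventually_elim
      case (elim n)
      have kN: "real (k n) = \<kappa> n * N n" and mN: "real (m n) = \<mu> n * N n" using elim by (auto simp: \<kappa>_def \<mu>_def)
      have pos: "\<kappa> n > 0" "\<mu> n > 0" using elim by (auto simp: \<kappa>_def \<mu>_def)
      have lN: "ln (N n) = (1 - g) * ln (real n)" using elim by (simp add: N_def ln_powr)
      have "ln (real (k n)) = ln (\<kappa> n) + (1 - g) * ln (real n)" "ln (real (m n)) = ln (\<mu> n) + (1 - g) * ln (real n)"
        unfolding kN mN using pos elim by (simp_all add: ln_mult lN)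
      note lns = this
      have "T n * N n = (- y - 2) + \<kappa> n * N n * ln y - \<kappa> n * N n * ln (\<kappa> n)
       - (ln (\<kappa> n) + (1 - g) * ln (real n)) + \<kappa> n * N n + \<mu> n * N n - \<mu> n * N n * ln (\<mu> n)
       + (g * (real (m n) - a * real (k n)) - 1) * ln (real n)"
        using elim by (simp add: T_def R_def field_simps)
      also have "\<dots> = (- y - 2) + real (k n) * ln y - real (k n) * ln (\<kappa> n)
       - (ln (\<kappa> n) + (1 - g) * ln (real n)) + real (k n) + real (m n) - real (m n) * ln (\<mu> n)
       + (g * real (m n) - (a * g) * real (k n) - 1) * ln (real n)"
        unfolding kN[symmetric] mN[symmetric] by (simp add: algebra_simps)
      also have "\<dots> = L n"
        unfolding ag L_def lns by (simp add: algebra_simps)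
      finally show ?case using elim by (simp add: field_simps)
    qed
    ultimately show ?thesis by (rule Lim_transform_eventually)
  qed
  ultimately show ?thesis unfolding \<beta> N_def by blast
qed

section \<open>Exponential tilting and concentration\<close>

lemma NB_CPSM_prob_eq:
  assumes "x \<in> partition_vectors n n"
  shows "NB_CPSM_prob \<alpha> z n x = fact n / (\<Sum>j=0..n. gen_fact_coeff n j \<alpha> * z ^ j) *
    ((- z) ^ (\<Sum>i=1..n. x i) * weight (fps_nth (neg_binomial_fps (- \<alpha>))) n x)"
proof -
  have "weight (\<lambda>i. z * (\<alpha> * pochhammer (1 - \<alpha>) (i - 1) / fact i)) n x
      = weight (\<lambda>i. - z * fps_nth (neg_binomial_fps (- \<alpha>)) i) n x"
  proof (intro weight_cong)
    fix i assume "i \<in> {1..n}"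
    then have "\<alpha> * pochhammer (1 - \<alpha>) (i - 1) / fact i = - fps_nth (neg_binomial_fps (- \<alpha>)) i"
      by (subst sibuya_fps_nth[symmetric]) (auto simp: sibuya_fps_def neg_binomial_fps_def)
    then show "z * (\<alpha> * pochhammer (1 - \<alpha>) (i - 1) / fact i) = - z * fps_nth (neg_binomial_fps (- \<alpha>)) i"
      by (simp only: mult_minus_left mult_minus_right)
  qed
  also have "\<dots> = (- z) ^ (\<Sum>i=1..n. x i) * weight (fps_nth (neg_binomial_fps (- \<alpha>))) n x"
    by (rule weight_cmult)
  finally show ?thesis
    using assms by (simp add: NB_CPSM_prob_def weight_def partition_vectors_def)
qed

lemma sum_weight_power:
  "(\<Sum>x\<in>partition_vectors n n. u ^ (\<Sum>i=1..n. x i) * weight (fps_nth (neg_binomial_fps a)) n x)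
    = nb_coeff a u n"
proof -
  have "nb_coeff a u n = partition_sum (fps_nth (fps_const u * neg_binomial_fps a)) n n"
    unfolding nb_coeff_def by (intro partition_sum_eq_fps_exp[symmetric]) auto
  also have "\<dots> = (\<Sum>x\<in>partition_vectors n n. weight (\<lambda>i. u * fps_nth (neg_binomial_fps a) i) n x)"
    unfolding partition_sum_def by (intro sum.cong weight_cong) auto
  finally show ?thesis by (simp only: weight_cmult)
qed

text \<open>
  Replacing \<open>- z\<close> by \<open>s * - z\<close> multiplies each weight by \<open>s ^ K\<close>, and the case \<open>s = 1\<close> identifies the
  normalising constant.
\<close>

lemma NB_CPSM_moment_generating:
  assumes total: "(\<Sum>x\<in>partition_vectors n n. NB_CPSM_prob \<alpha> z n x) = 1"
  shows "(\<Sum>x\<in>partition_vectors n n. NB_CPSM_prob \<alpha> z n x * s ^ (\<Sum>i=1..n. x i))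
    = nb_coeff (- \<alpha>) (s * - z) n / nb_coeff (- \<alpha>) (- z) n"
proof -
  define C where "C = fact n / (\<Sum>j=0..n. gen_fact_coeff n j \<alpha> * z ^ j)"
  have eq: "(\<Sum>x\<in>partition_vectors n n. NB_CPSM_prob \<alpha> z n x * s ^ (\<Sum>i=1..n. x i))
      = C * nb_coeff (- \<alpha>) (s * - z) n" for s
    unfolding sum_weight_power[symmetric] sum_distrib_left
    by (intro sum.cong) (simp_all only: NB_CPSM_prob_eq C_def power_mult_distrib mult_ac)
  from eq[of 1] total have "C * nb_coeff (- \<alpha>) (- z) n = 1" by simp
  moreover from this have "nb_coeff (- \<alpha>) (- z) n \<noteq> 0" by (metis mult_zero_right zero_neq_one)
  ultimately have "C = 1 / nb_coeff (- \<alpha>) (- z) n" by (simp add: eq_divide_eq)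
  then show ?thesis unfolding eq by simp
qed

text \<open>
  All probabilities have the sign of the normalising constant, and they sum to 1.
\<close>

lemma NB_CPSM_prob_nonneg:
  assumes \<alpha>: "\<alpha> < 0" and z: "z < 0"
    and total: "(\<Sum>x\<in>partition_vectors n n. NB_CPSM_prob \<alpha> z n x) = 1"
    and x: "x \<in> partition_vectors n n"
  shows "NB_CPSM_prob \<alpha> z n x \<ge> 0"
proof -
  define C where "C = fact n / (\<Sum>j=0..n. gen_fact_coeff n j \<alpha> * z ^ j)"
  have w: "(- z) ^ (\<Sum>i=1..n. x i) * weight (fps_nth (neg_binomial_fps (- \<alpha>))) n x \<ge> 0" for x
    unfolding weight_def using \<alpha> z
    by (intro mult_nonneg_nonneg prod_nonneg)
       (auto simp: neg_binomial_fps_def intro!: divide_nonneg_pos zero_le_power pochhammer_nonneg)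
  have "C * (\<Sum>x\<in>partition_vectors n n. (- z) ^ (\<Sum>i=1..n. x i) * weight (fps_nth (neg_binomial_fps (- \<alpha>))) n x) = 1"
    unfolding total[symmetric] sum_distrib_left by (intro sum.cong) (simp_all only: NB_CPSM_prob_eq C_def)
  moreover have "(\<Sum>x\<in>partition_vectors n n. (- z) ^ (\<Sum>i=1..n. x i) * weight (fps_nth (neg_binomial_fps (- \<alpha>))) n x) \<ge> 0"
    by (intro sum_nonneg w)
  ultimately have "C \<ge> 0"
    by (smt (verit) mult_nonpos_nonneg)
  then show ?thesis unfolding NB_CPSM_prob_eq[OF x] C_def[symmetric] using w by (intro mult_nonneg_nonneg[of C])
qed

text \<open>
  The exponent, divided by \<open>n powr (a / (1 + a))\<close>, tends to
  \<open>saddle_rate a y * (exp (l / (1 + a)) - 1) - l * q\<close>, because \<open>saddle_rate a u\<close> is homogeneous in \<open>u\<close>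
  of degree \<open>1 / (1 + a)\<close>.
\<close>

lemma exponential_moment_vanishes:
  assumes a: "a > 0" and y: "y > 0"
    and rate: "saddle_rate a y * (exp (l / (1 + a)) - 1) < l * q"
  shows "(\<lambda>n. exp (- l * q * real n powr (a / (1 + a))) * (nb_coeff a (exp l * y) n / nb_coeff a y n)) \<longlonglongrightarrow> 0"
proof -
  define N where "N n = real n powr (a / (1 + a))" for n :: nat
  obtain U where U: "\<forall>\<^sub>F n in sequentially. nb_coeff a (exp l * y) n \<le> exp (U n)"
      "(\<lambda>n. U n / N n) \<longlonglongrightarrow> saddle_rate a (exp l * y)"
    unfolding N_def using nb_coeff_upper_rate[OF a, of "exp l * y"] y by auto
  obtain L where L: "\<forall>\<^sub>F n in sequentially. exp (L n) \<le> nb_coeff a y n"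
      "(\<lambda>n. L n / N n) \<longlonglongrightarrow> saddle_rate a y"
    unfolding N_def using nb_coeff_lower_rate[OF a y] by auto
  have sr: "saddle_rate a (exp l * y) = saddle_rate a y * exp (l / (1 + a))"
  proof -
    have "a * (exp l * y) = exp l * (a * y)" by simp
    then have "(a * (exp l * y)) powr (1 / (1 + a)) = exp l powr (1 / (1 + a)) * (a * y) powr (1 / (1 + a))"
      using a y by (simp only: powr_mult exp_ge_zero mult_nonneg_nonneg less_imp_le)
    also have "exp l powr (1 / (1 + a)) = exp (l / (1 + a))" by (simp add: exp_powr_real)
    finally show ?thesis by (simp add: saddle_rate_def)
  qed
  define H where "H = - (l * q) + saddle_rate a (exp l * y) - saddle_rate a y"
  have H: "H < 0" using rate unfolding H_def sr by (simp add: algebra_simps)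
  have "(\<lambda>n. - (l * q) + U n / N n - L n / N n) \<longlonglongrightarrow> H"
    unfolding H_def by (intro tendsto_intros U L)
  moreover have N_top: "filterlim N at_top sequentially"
  proof -
    have "a / (1 + a) > 0" using a by simp
    then show ?thesis unfolding N_def by real_asymp
  qed
  ultimately have "filterlim (\<lambda>n. (- (l * q) + U n / N n - L n / N n) * N n) at_bot sequentially"
    using H by (intro filterlim_tendsto_neg_mult_at_bot)
  then have lim: "(\<lambda>n. exp ((- (l * q) + U n / N n - L n / N n) * N n)) \<longlonglongrightarrow> 0"
    by (rule filterlim_compose[OF exp_at_bot])
  have N_pos: "\<forall>\<^sub>F n in sequentially. N n > 0"
    using N_top by (auto simp: filterlim_at_top_dense)
  have nonneg: "nb_coeff a (exp l * y) n \<ge> 0" for n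
    unfolding nb_coeff_eq_sum using y by (intro sum_nonneg mult_nonneg_nonneg neg_binomial_fps_power_nonneg a) auto
  show ?thesis
    unfolding N_def[symmetric]
  proof (rule tendsto_sandwich[OF _ _ tendsto_const lim])
    show "\<forall>\<^sub>F n in sequentially. 0 \<le> exp (- l * q * N n) * (nb_coeff a (exp l * y) n / nb_coeff a y n)"
      using L(1)
    proof eventually_elim
      case (elim n)
      then have "nb_coeff a y n > 0" by (rule less_le_trans[OF exp_gt_zero])
      with nonneg[of n] show ?case by simp
    qed
    show "\<forall>\<^sub>F n in sequentially. exp (- l * q * N n) * (nb_coeff a (exp l * y) n / nb_coeff a y n)
        \<le> exp ((- (l * q) + U n / N n - L n / N n) * N n)"
      using L(1) U(1) N_pos
    proof eventually_elim
      case (elim n)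
      have "nb_coeff a (exp l * y) n / nb_coeff a y n \<le> exp (U n) / exp (L n)"
        using elim nonneg[of n] by (intro frac_le) auto
      then have "exp (- l * q * N n) * (nb_coeff a (exp l * y) n / nb_coeff a y n)
        \<le> exp (- l * q * N n) * (exp (U n) / exp (L n))"
        by (intro mult_left_mono) auto
      also have "\<dots> = exp (- l * q * N n + (U n - L n))"
        by (simp only: exp_add exp_diff)
      also have "- l * q * N n + (U n - L n) = (- (l * q) + U n / N n - L n / N n) * N n"
        using elim by (simp add: field_simps)
      finally show ?case .
    qed
  qed
qed

text \<open>
  As a function of \<open>l\<close> the left side vanishes at 0 with slope \<open>saddle_rate a y / (1 + a)\<close>. So any
  \<open>q\<close> other than this slope, which is the limiting constant, admits a good \<open>l\<close> on the appropriate
  side of 0.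
\<close>

lemma exists_tilt_above:
  assumes a: "a > 0" and q: "saddle_rate a y / (1 + a) < q"
  shows "\<exists>l>0. saddle_rate a y * (exp (l / (1 + a)) - 1) < l * q"
proof -
  let ?h = "\<lambda>l. saddle_rate a y * (exp (l / (1 + a)) - 1) - l * q"
  have "(?h has_real_derivative (saddle_rate a y / (1 + a) - q)) (at 0)"
    using a by (auto intro!: derivative_eq_intros)
  from DERIV_neg_dec_right[OF this] obtain d where "d > 0" "\<forall>h>0. h < d \<longrightarrow> ?h (0 + h) < ?h 0"
    using q by auto
  then have "?h (d / 2) < 0" by (auto dest!: spec[of _ "d / 2"])
  then show ?thesis using \<open>d > 0\<close> by (intro exI[of _ "d / 2"]) auto
qed

lemma exists_tilt_below:
  assumes a: "a > 0" and q: "q < saddle_rate a y / (1 + a)"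
  shows "\<exists>l<0. saddle_rate a y * (exp (l / (1 + a)) - 1) < l * q"
proof -
  let ?h = "\<lambda>l. saddle_rate a y * (exp (l / (1 + a)) - 1) - l * q"
  have "(?h has_real_derivative (saddle_rate a y / (1 + a) - q)) (at 0)"
    using a by (auto intro!: derivative_eq_intros)
  from DERIV_pos_inc_left[OF this] obtain d where "d > 0" "\<forall>h>0. h < d \<longrightarrow> ?h (0 - h) < ?h 0"
    using q by auto
  then have "?h (- (d / 2)) < 0" by (auto dest!: spec[of _ "d / 2"])
  then show ?thesis using \<open>d > 0\<close> by (intro exI[of _ "- (d / 2)"]) auto
qed

text \<open>
  Away from its jump the limiting distribution function is 0 or 1, so it suffices to show that the
  lower tail at \<open>q < c\<close> and the upper tail at \<open>q > c\<close> vanish. Both follow from Markov's inequality for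
  \<open>exp (l * (K - q * N))\<close> with \<open>l\<close> of the appropriate sign.
\<close>

theorem NB_CPSM_weak_limit:
  assumes \<alpha>: "\<alpha> < 0" and z: "z < 0"
    and pmf: "\<And>n. n \<ge> 1 \<Longrightarrow> has_joint_pmf n (Q n) (X n) (NB_CPSM_prob \<alpha> z n)"
  shows "weak_conv_m
          (\<lambda>n. distr (Q n) borel (\<lambda>\<omega>. real (\<Sum>r=1..n. X n r \<omega>) / real n powr (- \<alpha> / (1 - \<alpha>))))
          (return borel ((\<alpha> * z) powr (1 / (1 - \<alpha>)) / (- \<alpha>)))"
  unfolding weak_conv_m_def weak_conv_def
proof (intro allI impI)
  fix q :: real
  define a y where "a = - \<alpha>" and "y = - z"
  define N where "N n = real n powr (a / (1 + a))" for n :: nat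
  define c where "c = (a * y) powr (1 / (1 + a)) / a"
  have a: "a > 0" and y: "y > 0" using \<alpha> z by (auto simp: a_def y_def)
  have c_rate: "saddle_rate a y / (1 + a) = c"
  proof -
    have "1 + 1 / a = (1 + a) / a" using a by (simp add: field_simps)
    then show ?thesis using a by (simp add: saddle_rate_def c_def)
  qed
  have c_eq: "(\<alpha> * z) powr (1 / (1 - \<alpha>)) / (- \<alpha>) = c" by (simp add: c_def a_def y_def)
  let ?G = "cdf (return borel c)"
  let ?F = "\<lambda>n. cdf (distr (Q n) borel (\<lambda>\<omega>. real (\<Sum>r=1..n. X n r \<omega>) / real n powr (- \<alpha> / (1 - \<alpha>)))) q"
  let ?p = "\<lambda>n. NB_CPSM_prob \<alpha> z n" and ?K = "\<lambda>n x. \<Sum>i=1..n. (x i :: nat)"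
  have G: "?G q = (if c \<le> q then 1 else 0)" by (simp add: cdf_def measure_return)
  have F: "?F n = (\<Sum>x\<in>partition_vectors n n. if real (?K n x) \<le> N n * q then ?p n x else 0)" if "n \<ge> 1" for n
    using cdf_block_count[OF pmf[OF that], of "real n powr (- \<alpha> / (1 - \<alpha>))" q] that
    by (simp add: NB_CPSM_prob_def N_def a_def)
  have total: "(\<Sum>x\<in>partition_vectors n n. ?p n x) = 1" if "n \<ge> 1" for n
    using that by (intro sum_joint_pmf_eq_1[OF pmf]) (auto simp: NB_CPSM_prob_def)
  have nonneg: "?p n x \<ge> 0" if "n \<ge> 1" "x \<in> partition_vectors n n" for n x
    using that by (intro NB_CPSM_prob_nonneg \<alpha> z total)
  have chernoff: "(\<Sum>x\<in>partition_vectors n n. if A x then ?p n x else 0)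
      \<le> exp (- l * q * N n) * (nb_coeff a (exp l * y) n / nb_coeff a y n)"
    if n: "n \<ge> 1" and A: "\<And>x. A x \<Longrightarrow> l * (N n * q) \<le> l * real (?K n x)" for l n A
  proof -
    have "(\<Sum>x\<in>partition_vectors n n. if A x then ?p n x else 0)
      \<le> (\<Sum>x\<in>partition_vectors n n. exp (- l * q * N n) * (?p n x * exp l ^ ?K n x))"
    proof (intro sum_mono)
      fix x assume x: "x \<in> partition_vectors n n"
      have e: "exp (- l * q * N n) * (?p n x * exp l ^ ?K n x) = ?p n x * exp (l * real (?K n x) - l * (N n * q))"
      proof -
        have "exp (l * real (?K n x) - l * (N n * q)) = exp (- l * q * N n + real (?K n x) * l)"
          by (simp add: algebra_simps del: of_nat_sum)
        also have "\<dots> = exp (- l * q * N n) * exp l ^ ?K n x"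
          by (simp only: exp_add exp_of_nat_mult)
        finally show ?thesis by (simp only: mult_ac)
      qed
      show "(if A x then ?p n x else 0) \<le> exp (- l * q * N n) * (?p n x * exp l ^ ?K n x)"
      proof (cases "A x")
        case True
        have "?p n x * 1 \<le> ?p n x * exp (l * real (?K n x) - l * (N n * q))"
          using A[OF True] nonneg[OF n x] by (intro mult_left_mono) auto
        then show ?thesis unfolding e using True by simp
      qed (unfold e, use nonneg[OF n x] in simp)
    qed
    also have "\<dots> = exp (- l * q * N n) * (nb_coeff a (exp l * y) n / nb_coeff a y n)"
      using NB_CPSM_moment_generating[OF total[OF n], of "exp l"]
      by (simp only: sum_distrib_left[symmetric] a_def y_def)
    finally show ?thesis .
  qed
  have ev: "\<forall>\<^sub>F n in sequentially. n \<ge> (1::nat)" by (rule eventually_ge_at_top)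
  assume "isCont (cdf (return borel ((\<alpha> * z) powr (1 / (1 - \<alpha>)) / (- \<alpha>)))) q"
  then have "q \<noteq> c"
  proof -
    assume cont: "isCont (cdf (return borel ((\<alpha> * z) powr (1 / (1 - \<alpha>)) / (- \<alpha>)))) q"
    interpret prob_space "return borel c" by (rule prob_space_return) simp
    interpret finite_borel_measure "return borel c" by unfold_locales simp
    show ?thesis using cont unfolding c_eq isCont_cdf by (auto simp: measure_return)
  qed
  then consider "q < c" | "c < q" by linarith
  then have "?F \<longlonglongrightarrow> ?G q"
  proof cases
    case 1
    then obtain l where l: "l < 0" "saddle_rate a y * (exp (l / (1 + a)) - 1) < l * q"
      using exists_tilt_below[OF a, of q y] c_rate by auto
    have "?F \<longlonglongrightarrow> 0"
    proof (rule tendsto_sandwich[OF _ _ tendsto_const exponential_moment_vanishes[OF a y l(2)]])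
      show "\<forall>\<^sub>F n in sequentially. 0 \<le> ?F n" by (simp add: cdf_def)
      show "\<forall>\<^sub>F n in sequentially. ?F n \<le> exp (- l * q * real n powr (a / (1 + a)))
          * (nb_coeff a (exp l * y) n / nb_coeff a y n)"
        using ev
      proof eventually_elim
        case (elim n)
        show ?case
          unfolding F[OF elim] N_def[symmetric]
          using l(1) elim by (intro chernoff) (auto intro!: mult_left_mono_neg simp del: of_nat_sum)
      qed
    qed
    then show ?thesis using 1 G by simp
  next
    case 2
    then obtain l where l: "l > 0" "saddle_rate a y * (exp (l / (1 + a)) - 1) < l * q"
      using exists_tilt_above[OF a, of y q] c_rate by auto
    have "(\<lambda>n. 1 - ?F n) \<longlonglongrightarrow> 0"
    proof (rule tendsto_sandwich[OF _ _ tendsto_const exponential_moment_vanishes[OF a y l(2)]])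
      have compl: "1 - ?F n = (\<Sum>x\<in>partition_vectors n n. if \<not> real (?K n x) \<le> N n * q then ?p n x else 0)"
        if "n \<ge> 1" for n
      proof -
        have "1 - ?F n = (\<Sum>x\<in>partition_vectors n n. ?p n x)
            - (\<Sum>x\<in>partition_vectors n n. if real (?K n x) \<le> N n * q then ?p n x else 0)"
          by (simp only: F[OF that] total[OF that])
        also have "\<dots> = (\<Sum>x\<in>partition_vectors n n. if \<not> real (?K n x) \<le> N n * q then ?p n x else 0)"
          unfolding sum_subtractf[symmetric] by (intro sum.cong) auto
        finally show ?thesis .
      qed
      show "\<forall>\<^sub>F n in sequentially. 0 \<le> 1 - ?F n"
        using ev
      proof eventually_elim
        case (elim n)
        show ?case unfolding compl[OF elim] using nonneg[OF elim] by (intro sum_nonneg) auto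
      qed
      show "\<forall>\<^sub>F n in sequentially. 1 - ?F n \<le> exp (- l * q * real n powr (a / (1 + a)))
          * (nb_coeff a (exp l * y) n / nb_coeff a y n)"
        using ev
      proof eventually_elim
        case (elim n)
        show ?case
          unfolding compl[OF elim] N_def[symmetric]
          using l(1) elim by (intro chernoff) (auto intro!: mult_left_mono simp del: of_nat_sum)
      qed
    qed
    then have "(\<lambda>n. 1 - (1 - ?F n)) \<longlonglongrightarrow> 1 - 0" by (intro tendsto_diff tendsto_const)
    then show ?thesis using 2 G by simp
  qed
  then show "?F \<longlonglongrightarrow> cdf (return borel ((\<alpha> * z) powr (1 / (1 - \<alpha>)) / (- \<alpha>))) q"
    unfolding c_eq .
qed

section \<open>Both limits\<close>

theorem theorem4:
  fixes \<alpha> \<theta> z :: real and f :: "real \<Rightarrow> real"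
    and P :: "nat \<Rightarrow> 'a measure" and M :: "nat \<Rightarrow> nat \<Rightarrow> 'a \<Rightarrow> nat"
    and Q :: "nat \<Rightarrow> 'b measure" and N :: "nat \<Rightarrow> nat \<Rightarrow> 'b \<Rightarrow> nat"
  shows
    "(0 < \<alpha> \<and> \<alpha> < 1 \<and> \<theta> > - \<alpha> \<and> positive_stable_density \<alpha> f \<and>
      (\<forall>n\<ge>1. has_joint_pmf n (P n) (M n) (EP_SM_prob \<alpha> \<theta> n)) \<longrightarrow>
        weak_conv_m
          (\<lambda>n. distr (P n) borel (\<lambda>\<omega>. real (\<Sum>r=1..n. M n r \<omega>) / real n powr \<alpha>))
          (density lborel (scaled_ML_density \<alpha> \<theta> f))) \<and>
     (\<alpha> < 0 \<and> z < 0 \<and>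
      (\<forall>n\<ge>1. has_joint_pmf n (Q n) (N n) (NB_CPSM_prob \<alpha> z n)) \<longrightarrow>
        weak_conv_m
          (\<lambda>n. distr (Q n) borel
             (\<lambda>\<omega>. real (\<Sum>r=1..n. N n r \<omega>) / real n powr (- \<alpha> / (1 - \<alpha>))))
          (return borel ((\<alpha> * z) powr (1 / (1 - \<alpha>)) / (- \<alpha>))))"
proof (intro conjI impI)
  assume "0 < \<alpha> \<and> \<alpha> < 1 \<and> \<theta> > - \<alpha> \<and> positive_stable_density \<alpha> f \<and>
      (\<forall>n\<ge>1. has_joint_pmf n (P n) (M n) (EP_SM_prob \<alpha> \<theta> n))"
  then show "weak_conv_m
          (\<lambda>n. distr (P n) borel (\<lambda>\<omega>. real (\<Sum>r=1..n. M n r \<omega>) / real n powr \<alpha>))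
          (density lborel (scaled_ML_density \<alpha> \<theta> f))"
    by (intro EP_SM_weak_limit) blast+
next
  assume "\<alpha> < 0 \<and> z < 0 \<and>
      (\<forall>n\<ge>1. has_joint_pmf n (Q n) (N n) (NB_CPSM_prob \<alpha> z n))"
  then show "weak_conv_m
          (\<lambda>n. distr (Q n) borel
             (\<lambda>\<omega>. real (\<Sum>r=1..n. N n r \<omega>) / real n powr (- \<alpha> / (1 - \<alpha>))))
          (return borel ((\<alpha> * z) powr (1 / (1 - \<alpha>)) / (- \<alpha>)))"
    by (intro NB_CPSM_weak_limit) blast+
qed

end
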